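(* Let $\Omega\subset\mathbb{R}^N$ be a smooth bounded domain, $p>1$, let $f$ satisfy condition $(\mathcal C)$, and let $\rho:\Omega\to\mathbb{R}$ be a bounded nonnegative function not identically zero. Consider the inequality $$-\Delta_p u\ \ge\ \lambda\rho(x)f(u)\ \text{ in }\Omega,\qquad u\ge0\ \text{in }\Omega,\qquad u\in W_0^{1,p}(\Omega),$$ understood in the weak sense, for functions $u$ with values in $[0,a_f)$. (i) The inequality has no positive $C^1(\Omega)$ solution if $$\lambda\ >\ \Big(\frac p{p-1}\Big)^{p-1}\frac{N\,\|F\|_\infty^{p-1}}{\sup_{x\in\Omega}\{\rho_x(d_\Omega(x))\,d_\Omega(x)^p\}}.$$ (ii) If $\Omega=B_R$ is the ball of radius $R$ centered at the origin and $\rho(x)=|x|^\alpha$ with $\alpha>0$, the inequality has no positive $C^1(\Omega)$ solution if $$\lambda\ >\ \Big(\frac{\alpha+p}{p-1}\|F\|_\infty\Big)^{p-1}(\alpha+N)\,R^{-(\alpha+p)}.$$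
   Context: $\Delta_p u=\operatorname{div}(|\nabla u|^{p-2}\nabla u)$. Condition $(\mathcal C)$: $f:[0,a_f)\to[0,\infty)$ with $0<a_f\le\infty$ is a nondecreasing $C^1$ function with $f(u)>0$ for $u>0$. $\|F\|_\infty=\int_0^{a_f}f(s)^{-1/(p-1)}ds$. $d_\Omega(x)=\operatorname{dist}(x,\partial\Omega)$ and $\rho_x(r)=\inf\{\rho(y):|y-x|<r\}$. A weak solution of the inequality means $\rho f(u)\in L^1(\Omega)$ and $\int_\Omega|\nabla u|^{p-2}\nabla u\cdot\nabla\varphi\ge\lambda\int_\Omega\rho f(u)\varphi$ for all nonnegative $\varphi\in C_c^\infty(\Omega)$; positive means $u>0$ in $\Omega$. *)

theory Defs
  imports "HOL-Analysis.Analysis"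
begin

coinductive smooth_fn :: "(real^('n::finite)) set \<Rightarrow> (real^'n \<Rightarrow> real) \<Rightarrow> bool"
  for S where
  "continuous_on S f \<Longrightarrow> (\<forall>x\<in>S. (f has_derivative (\<lambda>h. g x \<bullet> h)) (at x))
   \<Longrightarrow> (\<forall>i. smooth_fn S (\<lambda>x. g x $ i)) \<Longrightarrow> smooth_fn S f"

definition grad :: "(real^'n \<Rightarrow> real) \<Rightarrow> real^'n \<Rightarrow> real^'n" where
  "grad u x = (THE g. (u has_derivative (\<lambda>h. g \<bullet> h)) (at x))"

definition C1_on :: "(real^'n) set \<Rightarrow> (real^'n \<Rightarrow> real) \<Rightarrow> bool" where
  "C1_on \<Omega> u \<longleftrightarrow> (\<exists>g. continuous_on \<Omega> g \<and>
      (\<forall>x\<in>\<Omega>. (u has_derivative (\<lambda>h. g x \<bullet> h)) (at x)))"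

definition test_fn :: "(real^'n) set \<Rightarrow> (real^'n \<Rightarrow> real) \<Rightarrow> bool" where
  "test_fn \<Omega> \<phi> \<longleftrightarrow> smooth_fn UNIV \<phi> \<and> compact (closure {x. \<phi> x \<noteq> 0})
      \<and> closure {x. \<phi> x \<noteq> 0} \<subseteq> \<Omega>"

definition smooth_bounded_domain :: "(real^'n) set \<Rightarrow> bool" where
  "smooth_bounded_domain \<Omega> \<longleftrightarrow> open \<Omega> \<and> connected \<Omega> \<and> \<Omega> \<noteq> {} \<and> bounded \<Omega> \<and>
     (\<forall>x0\<in>frontier \<Omega>. \<exists>U \<psi>. open U \<and> x0 \<in> U \<and> smooth_fn U \<psi> \<and>
         (\<forall>x\<in>U. grad \<psi> x \<noteq> 0) \<and> \<Omega> \<inter> U = {x\<in>U. \<psi> x < 0})"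

definition W01p_C1 :: "real \<Rightarrow> (real^'n) set \<Rightarrow> (real^'n \<Rightarrow> real) \<Rightarrow> bool" where
  "W01p_C1 p \<Omega> u \<longleftrightarrow>
     set_integrable lebesgue \<Omega> (\<lambda>x. \<bar>u x\<bar> powr p) \<and>
     set_integrable lebesgue \<Omega> (\<lambda>x. norm (grad u x) powr p) \<and>
     (\<exists>\<phi>. (\<forall>k. test_fn \<Omega> (\<phi> k)) \<and>
        (\<lambda>k. set_lebesgue_integral lebesgue \<Omega> (\<lambda>x. \<bar>\<phi> k x - u x\<bar> powr p)
           + set_lebesgue_integral lebesgue \<Omega> (\<lambda>x. norm (grad (\<phi> k) x - grad u x) powr p))
        \<longlonglongrightarrow> 0)"

definition condC :: "ereal \<Rightarrow> (real \<Rightarrow> real) \<Rightarrow> bool" where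
  "condC a f \<longleftrightarrow> 0 < a \<and>
     mono_on {s. 0 \<le> s \<and> ereal s < a} f \<and>
     (\<exists>f'. continuous_on {s. 0 \<le> s \<and> ereal s < a} f' \<and>
        (\<forall>s\<in>{s. 0 \<le> s \<and> ereal s < a}.
            (f has_real_derivative f' s) (at s within {s. 0 \<le> s \<and> ereal s < a}))) \<and>
     (\<forall>s. 0 \<le> s \<and> ereal s < a \<longrightarrow> 0 \<le> f s) \<and>
     (\<forall>s. 0 < s \<and> ereal s < a \<longrightarrow> 0 < f s)"

definition Fnorm :: "real \<Rightarrow> ereal \<Rightarrow> (real \<Rightarrow> real) \<Rightarrow> ennreal" where
  "Fnorm p a f = set_nn_integral lebesgue {s. 0 < s \<and> ereal s < a}
                    (\<lambda>s. ennreal (f s powr (-1 / (p - 1))))"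

definition pos_C1_weak_supersol ::
  "real \<Rightarrow> ereal \<Rightarrow> (real \<Rightarrow> real) \<Rightarrow> (real^'n) set \<Rightarrow> (real^'n \<Rightarrow> real) \<Rightarrow> real
     \<Rightarrow> (real^'n \<Rightarrow> real) \<Rightarrow> bool" where
  "pos_C1_weak_supersol p a f \<Omega> \<rho> lam u \<longleftrightarrow>
     C1_on \<Omega> u \<and> W01p_C1 p \<Omega> u \<and>
     (\<forall>x\<in>\<Omega>. 0 < u x \<and> ereal (u x) < a) \<and>
     set_integrable lebesgue \<Omega> (\<lambda>x. \<rho> x * f (u x)) \<and>
     (\<forall>\<phi>. test_fn \<Omega> \<phi> \<and> (\<forall>x. 0 \<le> \<phi> x) \<longrightarrow>
        set_lebesgue_integral lebesgue \<Omega>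
           (\<lambda>x. norm (grad u x) powr (p - 2) * (grad u x \<bullet> grad \<phi> x))
        \<ge> lam * set_lebesgue_integral lebesgue \<Omega> (\<lambda>x. \<rho> x * f (u x) * \<phi> x))"

end

theory Submission
  imports Defs
begin

text \<open>
  Let \<open>F\<close> be the primitive of \<open>f powr (- 1 / (p - 1))\<close> with \<open>F 0 = 0\<close>. For a positive
  supersolution \<open>u\<close>, the function \<open>v = F u\<close> satisfies \<open>- \<Delta>\<^sub>p v \<ge> \<lambda> \<rho>\<close> because \<open>f\<close> is nondecreasing,
  and \<open>0 \<le> v \<le> \<parallel>F\<parallel>\<close>. On a ball where \<open>\<rho> \<ge> m |x - c|\<^sup>\<alpha>\<close>, compare \<open>v\<close> with the radial barrier
  \<open>w\<close> solving \<open>- \<Delta>\<^sub>p w = \<lambda>' m |x - c|\<^sup>\<alpha>\<close> for some \<open>\<lambda>' < \<lambda>\<close> and vanishing on the boundary of a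
  slightly smaller ball: testing with \<open>(w - v)\<^sub>+\<^sup>2 / f u\<close> and using the monotonicity of the \<open>p\<close>-flux
  gives \<open>w \<le> v\<close>, hence \<open>w c \<le> \<parallel>F\<parallel>\<close>, which fails for large \<open>\<lambda>\<close>. Part (i) is the case
  \<open>\<alpha> = 0\<close>. That test function is only \<open>C\<^sup>1\<close>, so it is admitted by mollification. The weak equation
  for \<open>w\<close> is obtained without the divergence theorem, by differentiating the scaling law
  \<open>\<integral>|x|\<^sup>\<alpha> \<psi>(t x) dx = t powr (- N - \<alpha>) \<integral>|x|\<^sup>\<alpha> \<psi>(x) dx\<close> at \<open>t = 1\<close>.
\<close>

section \<open>Smooth kernels and convolutions\<close>

lemma grad_eqI:
  fixes u :: "real^'n::finite \<Rightarrow> real"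
  assumes "(u has_derivative (\<lambda>h. g \<bullet> h)) (at x)"
  shows "grad u x = g"
  unfolding grad_def
proof (rule the_equality)
  show "(u has_derivative (\<lambda>h. g \<bullet> h)) (at x)" by (rule assms)
next
  fix g' assume "(u has_derivative (\<lambda>h. g' \<bullet> h)) (at x)"
  from has_derivative_unique[OF this assms] have "\<And>h. g' \<bullet> h = g \<bullet> h" by meson
  then show "g' = g" using vector_eq_rdot by blast
qed

text \<open>The divisor \<open>t ^ m\<close> is carried along because differentiating
  \<open>exp (- 1 / t)\<close> produces powers of \<open>1 / t\<close>; the derivative of a profile
  is then a linear combination of profiles.\<close>

definition bump_profile :: "nat \<Rightarrow> real \<Rightarrow> real" where
  "bump_profile m t = (if t > 0 then exp (- 1 / t) / t ^ m else 0)"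

lemma bump_profile_tendsto_0: "(bump_profile m \<longlongrightarrow> 0) (at 0)"
proof -
  have "((\<lambda>x::real. (inverse x) ^ m / exp (inverse x)) \<longlongrightarrow> 0) (at_right 0)"
    using filterlim_compose[OF tendsto_power_div_exp_0 filterlim_inverse_at_top_right] .
  then have r: "(bump_profile m \<longlongrightarrow> 0) (at_right 0)"
  proof (rule Lim_transform_eventually)
    show "\<forall>\<^sub>F x in at_right 0. inverse x ^ m / exp (inverse x) = bump_profile m x"
      unfolding eventually_at_right_field bump_profile_def
      by (intro exI[of _ 1]) (auto simp: field_simps exp_minus power_inverse)
  qed
  have l: "(bump_profile m \<longlongrightarrow> 0) (at_left 0)"
    by (rule Lim_transform_eventually[OF tendsto_const])
       (auto simp: eventually_at_left_field bump_profile_def intro!: exI[of _ "-1"])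
  show ?thesis using l r by (simp add: filterlim_split_at)
qed

lemma bump_profile_has_real_derivative:
  "(bump_profile m has_real_derivative
     (bump_profile (m + 2) t - real m * bump_profile (m + 1) t)) (at t)"
proof -
  consider "t > 0" | "t < 0" | "t = 0" by linarith
  then show ?thesis
  proof cases
    case 1
    have "((\<lambda>t. exp (- 1 / t) / t ^ m) has_real_derivative
        (bump_profile (m + 2) t - real m * bump_profile (m + 1) t)) (at t)"
      using 1 power_eq_if[of t "m - 1"] unfolding bump_profile_def
      by (cases m) (auto intro!: derivative_eq_intros simp: field_simps power2_eq_square)
    then show ?thesis
      by (rule DERIV_cong_ev[THEN iffD1, OF refl _ refl, rotated])
         (use 1 in \<open>auto simp: bump_profile_def eventually_nhds intro!: exI[of _ "{0<..}"]\<close>)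
  next
    case 2
    have "((\<lambda>t. 0) has_real_derivative
        (bump_profile (m + 2) t - real m * bump_profile (m + 1) t)) (at t)"
      using 2 by (simp add: bump_profile_def)
    then show ?thesis
      by (rule DERIV_cong_ev[THEN iffD1, OF refl _ refl, rotated])
         (use 2 in \<open>auto simp: bump_profile_def eventually_nhds intro!: exI[of _ "{..<0}"]\<close>)
  next
    case 3
    \<comment> \<open>The difference quotient of the profile \<open>m\<close> at 0 is the profile
      \<open>Suc m\<close>, which tends to 0.\<close>
    have "((\<lambda>h. (bump_profile m (0 + h) - bump_profile m 0) / h) \<longlongrightarrow> 0) (at 0)"
      by (rule Lim_transform_eventually[OF bump_profile_tendsto_0[of "Suc m"]])
         (auto simp: bump_profile_def eventually_at_filter field_simps)
    then show ?thesis using 3 by (simp add: DERIV_def bump_profile_def)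
  qed
qed

text \<open>Being closed under partial derivatives, this class makes coinduction on smoothness possible.\<close>

inductive kernel_class :: "real \<Rightarrow> (real^'n::finite \<Rightarrow> real) \<Rightarrow> bool" for e where
  const: "kernel_class e (\<lambda>x. c)"
| coord: "kernel_class e (\<lambda>x. x $ i)"
| bump: "kernel_class e (\<lambda>x. bump_profile m (e - x \<bullet> x))"
| add: "kernel_class e f \<Longrightarrow> kernel_class e g \<Longrightarrow> kernel_class e (\<lambda>x. f x + g x)"
| mult: "kernel_class e f \<Longrightarrow> kernel_class e g \<Longrightarrow> kernel_class e (\<lambda>x. f x * g x)"

lemma kernel_class_has_derivative:
  assumes "kernel_class e f"
  shows "\<exists>g. (\<forall>x. (f has_derivative (\<lambda>h. g x \<bullet> h)) (at x)) \<and> (\<forall>i. kernel_class e (\<lambda>x. g x $ i))"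
  using assms
proof induction
  case (const c)
  show ?case by (rule exI[of _ "\<lambda>x. 0"]) (auto intro: kernel_class.const)
next
  case (coord i)
  have "((\<lambda>x. x $ i) has_derivative (\<lambda>h. axis i 1 \<bullet> h)) (at x)" for x :: "real^'a"
    by (rule has_derivative_eq_rhs[OF bounded_linear_imp_has_derivative[OF bounded_linear_vec_nth]])
       (auto simp: inner_axis')
  then show ?case by (intro exI[of _ "\<lambda>x. axis i 1"]) (auto intro: kernel_class.const)
next
  case (bump m)
  define d where "d t = bump_profile (m + 2) t - real m * bump_profile (m + 1) t" for t
  have der: "((\<lambda>x. bump_profile m (e - x \<bullet> x)) has_derivative (\<lambda>h. ((-2 * d (e - x \<bullet> x)) *\<^sub>R x) \<bullet> h)) (at x)"
    for x :: "real^'a"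
  proof -
    have 1: "(bump_profile m has_derivative (*) (d (e - x \<bullet> x))) (at (e - x \<bullet> x))"
      using bump_profile_has_real_derivative unfolding has_field_derivative_def d_def .
    have 2: "((\<lambda>x. e - x \<bullet> x) has_derivative (\<lambda>h. - (x \<bullet> h + h \<bullet> x))) (at x)"
      by (auto intro!: derivative_eq_intros)
    show ?thesis
      by (rule has_derivative_eq_rhs[OF has_derivative_compose[OF 2 1]])
         (auto simp: inner_commute algebra_simps)
  qed
  have "kernel_class e (\<lambda>x. ((-2 * d (e - x \<bullet> x)) *\<^sub>R x) $ i)" for i :: 'a
  proof -
    have "kernel_class e (\<lambda>x. (-2 * (bump_profile (m + 2) (e - x \<bullet> x) + (- real m) * bump_profile (m + 1) (e - x \<bullet> x))) * x $ i)"
      by (intro kernel_class.intros)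
    then show ?thesis by (simp add: d_def)
  qed
  with der show ?case by (intro exI[of _ "\<lambda>x. (-2 * d (e - x \<bullet> x)) *\<^sub>R x"]) auto
next
  case (add f g)
  then obtain f' g' where
    "\<And>x. (f has_derivative (\<lambda>h. f' x \<bullet> h)) (at x)" "\<And>i. kernel_class e (\<lambda>x. f' x $ i)"
    "\<And>x. (g has_derivative (\<lambda>h. g' x \<bullet> h)) (at x)" "\<And>i. kernel_class e (\<lambda>x. g' x $ i)" by blast
  then show ?case
    by (intro exI[of _ "\<lambda>x. f' x + g' x"])
       (auto intro!: kernel_class.add derivative_eq_intros simp: inner_add_left)
next
  case (mult f g)
  then obtain f' g' where
    "\<And>x. (f has_derivative (\<lambda>h. f' x \<bullet> h)) (at x)" "\<And>i. kernel_class e (\<lambda>x. f' x $ i)"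
    "\<And>x. (g has_derivative (\<lambda>h. g' x \<bullet> h)) (at x)" "\<And>i. kernel_class e (\<lambda>x. g' x $ i)" by blast
  with mult.hyps show ?case
    by (intro exI[of _ "\<lambda>x. f x *\<^sub>R g' x + g x *\<^sub>R f' x"])
       (auto intro!: kernel_class.add kernel_class.mult derivative_eq_intros simp: inner_add_left)
qed

lemma has_derivative_at_imp_continuous_on:
  assumes "\<And>x. (f has_derivative f' x) (at x)"
  shows "continuous_on S f"
  using assms by (meson continuous_at_imp_continuous_on has_derivative_continuous)

lemma kernel_class_continuous:
  assumes "kernel_class e f" shows "continuous_on S f"
proof -
  obtain g where "\<And>x. (f has_derivative (\<lambda>h. g x \<bullet> h)) (at x)"
    using kernel_class_has_derivative[OF assms] by blast
  then show ?thesis by (rule has_derivative_at_imp_continuous_on)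
qed

lemma continuous_on_vec_lambda_components:
  fixes g :: "'a::topological_space \<Rightarrow> real^'n::finite"
  assumes "\<And>i. continuous_on S (\<lambda>x. g x $ i)"
  shows "continuous_on S g"
  using continuous_on_vec_lambda[of S "\<lambda>i x. g x $ i"] assms by simp

text \<open>Differentiation under the integral in gradient form. The parameter type is general
  because the parameter is a point of space for convolutions and a real dilation factor for the
  scaling identity.\<close>

lemma leibniz_gradient:
  fixes f :: "'x::euclidean_space \<Rightarrow> 'y::euclidean_space \<Rightarrow> real"
  assumes der: "\<And>x y. ((\<lambda>x. f x y) has_derivative (\<lambda>h. g x y \<bullet> h)) (at x)"
    and g: "continuous_on UNIV (\<lambda>z. g (fst z) (snd z))"
    and f: "\<And>x. continuous_on (cbox a b) (f x)"
  shows "((\<lambda>x. integral (cbox a b) (f x)) has_derivative (\<lambda>h. integral (cbox a b) (g x) \<bullet> h)) (at x)"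
proof -
  have "((\<lambda>x. integral (cbox a b) (f x)) has_derivative integral (cbox a b) (\<lambda>y. blinfun_inner_right (g x y))) (at x within UNIV)"
  proof (rule leibniz_rule)
    show "continuous_on (UNIV \<times> cbox a b) (\<lambda>(x, t). blinfun_inner_right (g x t))"
      unfolding split_beta
      by (intro bounded_linear.continuous_on[OF bounded_linear_blinfun_inner_right] continuous_on_subset[OF g]) auto
  qed (use der f in \<open>auto intro: integrable_continuous\<close>)
  moreover have "g x integrable_on cbox a b"
    by (intro integrable_continuous continuous_on_compose2[OF g, of _ "\<lambda>y. (x, y)", simplified] continuous_intros)
  then have "integral (cbox a b) (\<lambda>y. blinfun_inner_right (g x y)) = blinfun_inner_right (integral (cbox a b) (g x))"
    using integral_linear[OF _ bounded_linear_blinfun_inner_right, of "g x" "cbox a b"] by (simp add: o_def)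
  ultimately show ?thesis by (simp add: blinfun_inner_right.rep_eq)
qed

lemma convolution_has_derivative:
  fixes \<phi> :: "real^'n::finite \<Rightarrow> real"
  assumes \<phi>: "continuous_on UNIV \<phi>"
    and k: "\<And>x. (k has_derivative (\<lambda>h. g x \<bullet> h)) (at x)" and g: "continuous_on UNIV g"
  shows "((\<lambda>x. integral (cbox a b) (\<lambda>y. \<phi> y * k (x - y))) has_derivative
          (\<lambda>h. integral (cbox a b) (\<lambda>y. \<phi> y *\<^sub>R g (x - y)) \<bullet> h)) (at x)"
proof (rule leibniz_gradient)
  have kc: "continuous_on UNIV k" using k by (rule has_derivative_at_imp_continuous_on)
  fix x y :: "real^'n"
  have "((\<lambda>x. x - y) has_derivative (\<lambda>h. h)) (at x)" by (auto intro!: derivative_eq_intros)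
  from has_derivative_compose[OF this k]
  show "((\<lambda>x. \<phi> y * k (x - y)) has_derivative (\<lambda>h. (\<phi> y *\<^sub>R g (x - y)) \<bullet> h)) (at x)"
    by (auto intro!: derivative_eq_intros)
  show "continuous_on UNIV (\<lambda>z. \<phi> (snd z) *\<^sub>R g (fst z - snd z))"
    by (intro continuous_intros continuous_on_compose2[OF \<phi>] continuous_on_compose2[OF g]) auto
  show "continuous_on (cbox a b) (\<lambda>y. \<phi> y * k (x - y))"
    by (intro continuous_intros continuous_on_compose2[OF \<phi>] continuous_on_compose2[OF kc]) auto
qed

text \<open>Every derivative can be put on the kernel, so \<open>\<phi>\<close> need only be
  continuous. The coinduction invariant \<open>X\<close> consists of the convolutions of the fixed
  \<open>\<phi>\<close> with arbitrary members of \<open>kernel_class\<close>.\<close>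

lemma smooth_convolution:
  fixes \<phi> :: "real^'n::finite \<Rightarrow> real"
  assumes \<phi>: "continuous_on UNIV \<phi>" and k: "kernel_class e k"
  shows "smooth_fn UNIV (\<lambda>x. integral (cbox a b) (\<lambda>y. \<phi> y * k (x - y)))"
proof -
  define X where "X F \<longleftrightarrow> (\<exists>k. kernel_class e k \<and> F = (\<lambda>x. integral (cbox a b) (\<lambda>y. \<phi> y * k (x - y))))" for F
  have "X (\<lambda>x. integral (cbox a b) (\<lambda>y. \<phi> y * k (x - y)))" unfolding X_def using k by blast
  then show ?thesis
  proof (rule smooth_fn.coinduct)
    fix F assume "X F"
    then obtain k where k: "kernel_class e k" and F: "F = (\<lambda>x. integral (cbox a b) (\<lambda>y. \<phi> y * k (x - y)))"
      unfolding X_def by blast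
    from kernel_class_has_derivative[OF k] obtain g where
      g: "\<And>x. (k has_derivative (\<lambda>h. g x \<bullet> h)) (at x)" and gi: "\<And>i. kernel_class e (\<lambda>x. g x $ i)" by blast
    have gc: "continuous_on UNIV g"
      by (intro continuous_on_vec_lambda_components kernel_class_continuous[OF gi])
    define G where "G x = integral (cbox a b) (\<lambda>y. \<phi> y *\<^sub>R g (x - y))" for x
    have der: "(F has_derivative (\<lambda>h. G x \<bullet> h)) (at x)" for x
      unfolding F G_def by (rule convolution_has_derivative[OF \<phi> g gc])
    \<comment> \<open>Taking a component commutes with the integral, so each partial derivative is
      again a convolution with a kernel of the class.\<close>
    have "(\<lambda>x. G x $ i) = (\<lambda>x. integral (cbox a b) (\<lambda>y. \<phi> y * (g (x - y) $ i)))" for i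
    proof
      fix x
      have "(\<lambda>y. \<phi> y *\<^sub>R g (x - y)) integrable_on cbox a b"
        by (intro integrable_continuous continuous_intros continuous_on_compose2[OF \<phi>] continuous_on_compose2[OF gc]) auto
      from integral_linear[OF this bounded_linear_vec_nth[of i]]
      show "G x $ i = integral (cbox a b) (\<lambda>y. \<phi> y * (g (x - y) $ i))"
        by (simp add: G_def o_def)
    qed
    then have "X (\<lambda>x. G x $ i)" for i unfolding X_def using gi by blast
    moreover have "continuous_on UNIV F" using der by (rule has_derivative_at_imp_continuous_on)
    ultimately show "\<exists>f g. F = f \<and> continuous_on UNIV f \<and> (\<forall>x\<in>UNIV. (f has_derivative (\<bullet>) (g x)) (at x)) \<and>
        (\<forall>i. X (\<lambda>x. g x $ i) \<or> smooth_fn UNIV (\<lambda>x. g x $ i))" using der by blast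
  qed
qed

section \<open>Mollification\<close>

text \<open>A bridge between two integrals: differentiation under the integral is done over a box,
  changes of variables are done for \<open>lborel\<close>.\<close>

lemma compact_support_lborel:
  fixes f :: "'a::euclidean_space \<Rightarrow> 'b::euclidean_space"
  assumes f: "continuous_on UNIV f" and z: "\<And>x. x \<notin> cbox a b \<Longrightarrow> f x = 0"
  shows "integrable lborel f" "integral\<^sup>L lborel f = integral (cbox a b) f"
proof -
  have "integrable lborel (\<lambda>x. indicator (cbox a b) x *\<^sub>R f x)"
    by (intro borel_integrable_compact compact_cbox continuous_on_subset[OF f]) auto
  moreover have eq: "(\<lambda>x. indicator (cbox a b) x *\<^sub>R f x) = f"
    using z by (auto simp: indicator_def)
  ultimately show i: "integrable lborel f" by simp
  have "(\<lambda>x. if x \<in> cbox a b then f x else 0) = f" using z by auto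
  then show "integral\<^sup>L lborel f = integral (cbox a b) f"
    using integral_restrict_UNIV[of "cbox a b" f] integral_lborel[OF i] by simp
qed

lemma lborel_integral_affine:
  fixes f :: "'a::euclidean_space \<Rightarrow> 'b::{banach, second_countable_topology}"
  assumes [measurable]: "f \<in> borel_measurable borel" and c: "c \<noteq> 0"
  shows "integral\<^sup>L lborel f = \<bar>c\<bar> ^ DIM('a) *\<^sub>R integral\<^sup>L lborel (\<lambda>x. f (t + c *\<^sub>R x))"
proof -
  have "integral\<^sup>L lborel f = integral\<^sup>L (density (distr lborel borel (\<lambda>x. t + c *\<^sub>R x)) (\<lambda>_. \<bar>c\<bar>^DIM('a))) f"
    using lborel_affine[OF c, of t] by simp
  also have "\<dots> = \<bar>c\<bar> ^ DIM('a) *\<^sub>R integral\<^sup>L lborel (\<lambda>x. f (t + c *\<^sub>R x))"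
    by (simp add: integral_density integral_distr)
  finally show ?thesis .
qed

lemma compact_support_uniform_continuity:
  fixes f :: "'a::euclidean_space \<Rightarrow> 'b::real_normed_vector"
  assumes f: "continuous_on UNIV f" and z: "\<And>x. x \<notin> cball c r \<Longrightarrow> f x = 0" and d: "\<delta> > 0"
  shows "\<exists>\<epsilon>>0. \<forall>x z. norm z < \<epsilon> \<longrightarrow> norm (f (x - z) - f x) \<le> \<delta>"
proof -
  \<comment> \<open>The margins are for shifts shorter than 1: from radius \<open>r + 1\<close> such
    a shift stays within \<open>r + 2\<close>, and from beyond \<open>r + 1\<close> it stays outside
    \<open>cball c r\<close>, where \<open>f\<close> vanishes.\<close>
  have "uniformly_continuous_on (cball c (r + 2)) f"
    by (intro compact_uniformly_continuous continuous_on_subset[OF f]) auto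
  then obtain e where e: "e > 0"
    "\<And>x y. x \<in> cball c (r + 2) \<Longrightarrow> y \<in> cball c (r + 2) \<Longrightarrow> dist y x < e \<Longrightarrow> dist (f y) (f x) < \<delta>"
    unfolding uniformly_continuous_on_def using d by metis
  have "norm (f (x - z) - f x) \<le> \<delta>" if zn: "norm z < min e 1" for x z
  proof (cases "x \<in> cball c (r + 1)")
    case True
    have "dist (x - z) x = norm z" by (simp add: dist_norm)
    moreover have "dist c (x - z) \<le> dist c x + dist x (x - z)" by (rule dist_triangle)
    ultimately have "x - z \<in> cball c (r + 2)" "x \<in> cball c (r + 2)" "dist (x - z) x < e"
      using True zn by (auto simp: dist_commute)
    then show ?thesis using e(2)[of x "x - z"] by (simp add: dist_norm)
  next
    case False
    have "dist c x \<le> dist c (x - z) + dist (x - z) x" by (rule dist_triangle)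
    then have "x - z \<notin> cball c r" "x \<notin> cball c r" using False zn by (auto simp: dist_norm)
    then show ?thesis using z d by auto
  qed
  then show ?thesis using e(1) by (intro exI[of _ "min e 1"]) auto
qed

lemma mollifier_exists:
  assumes e: "e > 0"
  shows "\<exists>\<eta> :: real^'n::finite \<Rightarrow> real. kernel_class (e\<^sup>2) \<eta> \<and> (\<forall>x. 0 \<le> \<eta> x) \<and>
     (\<forall>x. e \<le> norm x \<longrightarrow> \<eta> x = 0) \<and> integral\<^sup>L lborel \<eta> = 1"
proof -
  define h :: "real^'n \<Rightarrow> real" where "h x = bump_profile 0 (e\<^sup>2 - x \<bullet> x)" for x
  have kh: "kernel_class (e\<^sup>2) h" unfolding h_def by (rule kernel_class.bump)
  have ch: "continuous_on S h" for S by (rule kernel_class_continuous[OF kh])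
  have h0: "0 \<le> h x" for x by (simp add: h_def bump_profile_def)
  have hz: "h x = 0" if "e \<le> norm x" for x
  proof -
    have "e\<^sup>2 \<le> x \<bullet> x" using that e by (simp add: dot_square_norm)
    then show ?thesis by (simp add: h_def bump_profile_def)
  qed
  obtain a where a: "cball (0::real^'n) e \<subseteq> box (-a) a" using bounded_subset_box_symmetric[OF bounded_cball] by blast
  have hz': "h x = 0" if "x \<notin> cbox (-a) a" for x
    using that a box_subset_cbox hz[of x] by (meson mem_cball_0 nle_le subsetD)
  define Z where "Z = integral\<^sup>L lborel h"
  have Z: "Z = integral (cbox (-a) a) h" unfolding Z_def by (rule compact_support_lborel(2)[OF ch hz'])
  have 0: "0 \<in> box (-a) a" using a e by auto
  \<comment> \<open>A nonnegative continuous function with zero integral over a box with nonempty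
    interior vanishes on it, but \<open>h 0\<close> is \<open>exp (- 1 / e\<^sup>2)\<close>.\<close>
  have "Z \<noteq> 0"
  proof
    assume "Z = 0"
    then have "(h has_integral 0) (cbox (-a) a)"
      using Z integrable_continuous[OF ch] by (metis has_integral_integral)
    then have "h 0 = 0"
      by (rule has_integral_0_cbox_imp_0[OF ch h0]) (use 0 box_subset_cbox in auto)
    then show False using e by (simp add: h_def bump_profile_def)
  qed
  moreover have "0 \<le> Z" unfolding Z_def using h0 by simp
  ultimately have "Z > 0" by simp
  have "kernel_class (e\<^sup>2) (\<lambda>x. (1 / Z) * h x)" by (intro kernel_class.mult kernel_class.const kh)
  moreover have "integral\<^sup>L lborel (\<lambda>x. (1 / Z) * h x) = 1"
    using \<open>Z > 0\<close> unfolding Z_def by simp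
  ultimately show ?thesis using \<open>Z > 0\<close> h0 hz by (intro exI[of _ "\<lambda>x. (1 / Z) * h x"]) auto
qed

text \<open>As \<open>\<eta>\<close> has mass 1, \<open>F x\<close> is the average of a constant,
  and the error is the \<open>\<eta>\<close>-average of \<open>F (x - z) - F x\<close>. Values are
  vectors so that the bound serves a function and its gradient alike.\<close>

lemma kernel_average_error:
  fixes F :: "real^'n::finite \<Rightarrow> 'b::euclidean_space"
  assumes F: "continuous_on UNIV F" and \<eta>: "continuous_on UNIV \<eta>"
    and n: "\<And>x. 0 \<le> \<eta> x" and z: "\<And>x. x \<notin> cbox a b \<Longrightarrow> \<eta> x = 0"
    and one: "integral\<^sup>L lborel \<eta> = 1"
    and err: "\<And>z. \<eta> z \<noteq> 0 \<Longrightarrow> norm (F (x - z) - F x) \<le> \<delta>"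
  shows "norm (integral (cbox a b) (\<lambda>z. \<eta> z *\<^sub>R F (x - z)) - F x) \<le> \<delta>"
proof -
  have I: "integral (cbox a b) \<eta> = 1" using compact_support_lborel(2)[OF \<eta> z] one by simp
  have \<eta>i: "\<eta> integrable_on cbox a b" by (intro integrable_continuous continuous_on_subset[OF \<eta>]) auto
  have *: "continuous_on (cbox a b) \<eta>" "continuous_on (cbox a b) (\<lambda>z. F (x - z))"
    by (auto intro!: continuous_on_subset[OF \<eta>] continuous_on_compose2[OF F] continuous_intros)
  have i1: "(\<lambda>z. \<eta> z *\<^sub>R F (x - z)) integrable_on cbox a b"
    by (intro integrable_continuous continuous_intros *)
  have i2: "(\<lambda>z. \<eta> z *\<^sub>R F x) integrable_on cbox a b"
    by (intro integrable_continuous continuous_intros *)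
  have "integral (cbox a b) (\<lambda>z. \<eta> z *\<^sub>R F x) = F x"
    using integral_linear[OF \<eta>i bounded_linear_scaleR_left[of "F x"]] I by (simp add: o_def)
  then have "integral (cbox a b) (\<lambda>z. \<eta> z *\<^sub>R F (x - z)) - F x
     = integral (cbox a b) (\<lambda>z. \<eta> z *\<^sub>R F (x - z) - \<eta> z *\<^sub>R F x)"
    using integral_diff[OF i1 i2] by simp
  also have "norm \<dots> \<le> integral (cbox a b) (\<lambda>z. \<eta> z * \<delta>)"
  proof (rule integral_norm_bound_integral)
    show "(\<lambda>z. \<eta> z *\<^sub>R F (x - z) - \<eta> z *\<^sub>R F x) integrable_on cbox a b" using i1 i2 by (rule integrable_diff)
    show "(\<lambda>z. \<eta> z * \<delta>) integrable_on cbox a b" by (intro integrable_continuous continuous_intros *)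
    fix z
    show "norm (\<eta> z *\<^sub>R F (x - z) - \<eta> z *\<^sub>R F x) \<le> \<eta> z * \<delta>"
      using err[of z] n[of z] by (cases "\<eta> z = 0") (auto simp: scaleR_diff_right[symmetric] mult_left_mono)
  qed
  also have "\<dots> = \<delta>" using I by simp
  finally show ?thesis .
qed

lemma has_derivative_vanishes_off_closed:
  fixes \<phi> :: "'a::real_inner \<Rightarrow> real"
  assumes der: "(\<phi> has_derivative (\<lambda>h. g \<bullet> h)) (at x)"
    and "closed K" and z: "\<And>y. y \<notin> K \<Longrightarrow> \<phi> y = 0" and "x \<notin> K"
  shows "g = 0"
proof -
  have "((\<lambda>x. 0) has_derivative (\<lambda>h. g \<bullet> h)) (at x)"
    by (rule has_derivative_transform_within_open[OF der, of "- K"])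
       (use assms in \<open>auto simp: open_Compl\<close>)
  from has_derivative_unique[OF this has_derivative_const]
  have "\<And>h. g \<bullet> h = 0" by meson
  from this[of g] show ?thesis by simp
qed

text \<open>Convolution with a kernel of small radius is close to \<open>\<phi>\<close> in the C1
  norm, by uniform continuity of \<open>\<phi>\<close> and \<open>G\<close>, and enlarges the
  support by at most that radius.\<close>

lemma C1_mollification:
  fixes \<phi> :: "real^'n::finite \<Rightarrow> real"
  assumes der: "\<And>x. (\<phi> has_derivative (\<lambda>h. G x \<bullet> h)) (at x)" and G: "continuous_on UNIV G"
    and z: "\<And>x. x \<notin> cball c r \<Longrightarrow> \<phi> x = 0" and n: "\<And>x. 0 \<le> \<phi> x"
    and r: "r < R" and d: "\<delta> > 0"
  shows "\<exists>\<Phi>. smooth_fn UNIV \<Phi> \<and> (\<forall>x. 0 \<le> \<Phi> x) \<and> (\<forall>x. x \<notin> cball c R \<longrightarrow> \<Phi> x = 0) \<and>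
     (\<forall>x. \<bar>\<Phi> x - \<phi> x\<bar> \<le> \<delta>) \<and> (\<forall>x. norm (grad \<Phi> x - G x) \<le> \<delta>)"
proof -
  have \<phi>: "continuous_on UNIV \<phi>" using der by (rule has_derivative_at_imp_continuous_on)
  have Gz: "G x = 0" if "x \<notin> cball c r" for x
    using has_derivative_vanishes_off_closed[OF der closed_cball z that] .
  obtain e1 where e1: "e1 > 0" "\<And>x z. norm z < e1 \<Longrightarrow> norm (\<phi> (x - z) - \<phi> x) \<le> \<delta>"
    using compact_support_uniform_continuity[OF \<phi> z d] by metis
  obtain e2 where e2: "e2 > 0" "\<And>x z. norm z < e2 \<Longrightarrow> norm (G (x - z) - G x) \<le> \<delta>"
    using compact_support_uniform_continuity[OF G Gz d] by metis
  \<comment> \<open>\<open>R - r\<close> keeps the support inside \<open>cball c R\<close>;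
    \<open>e1\<close> and \<open>e2\<close> control the errors of the function and of the
    gradient.\<close>
  define e where "e = min (R - r) (min e1 e2)"
  have e: "e > 0" using e1 e2 r by (simp add: e_def)
  obtain \<eta> :: "real^'n \<Rightarrow> real" where k: "kernel_class (e\<^sup>2) \<eta>" and \<eta>n: "\<And>x. 0 \<le> \<eta> x"
     and \<eta>z: "\<And>x. e \<le> norm x \<Longrightarrow> \<eta> x = 0" and one: "integral\<^sup>L lborel \<eta> = 1"
    using mollifier_exists[OF e] by blast
  have \<eta>: "continuous_on UNIV \<eta>" by (rule kernel_class_continuous[OF k])
  obtain a where a: "cball (0::real^'n) e \<subseteq> cbox (-a) a" using bounded_subset_cbox_symmetric[OF bounded_cball] by blast
  obtain b where b: "cball c r \<subseteq> cbox (-b) b" using bounded_subset_cbox_symmetric[OF bounded_cball] by blast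
  have \<eta>z': "\<eta> x = 0" if "x \<notin> cbox (-a) a" for x
    using that a \<eta>z[of x] by (meson mem_cball_0 nle_le subsetD)
  define \<Phi> where "\<Phi> x = integral (cbox (-b) b) (\<lambda>y. \<phi> y * \<eta> (x - y))" for x
  have smooth: "smooth_fn UNIV \<Phi>" unfolding \<Phi>_def by (rule smooth_convolution[OF \<phi> k])
  \<comment> \<open>The defining form leaves \<open>x\<close> in the kernel and gives smoothness.
    Reflecting the variable moves \<open>x\<close> into \<open>\<phi>\<close>, so the gradient
    becomes an average of \<open>G\<close>.\<close>
  have alt: "\<Phi> x = integral (cbox (-a) a) (\<lambda>z. \<eta> z * \<phi> (x - z))" for x
  proof -
    have c1: "continuous_on UNIV (\<lambda>y. \<phi> y * \<eta> (x - y))" and c2: "continuous_on UNIV (\<lambda>z. \<eta> z * \<phi> (x - z))"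
      by (auto intro!: continuous_intros continuous_on_compose2[OF \<phi>] continuous_on_compose2[OF \<eta>])
    have "\<Phi> x = integral\<^sup>L lborel (\<lambda>y. \<phi> y * \<eta> (x - y))"
      unfolding \<Phi>_def by (rule compact_support_lborel(2)[OF c1, symmetric]) (use b z in \<open>metis mult_zero_left subsetD\<close>)
    also have "\<dots> = integral\<^sup>L lborel (\<lambda>z. \<eta> z * \<phi> (x - z))"
      using lborel_integral_affine[of "\<lambda>y. \<phi> y * \<eta> (x - y)" "-1" x] borel_measurable_continuous_onI[OF c1]
      by (simp add: mult.commute)
    also have "\<dots> = integral (cbox (-a) a) (\<lambda>z. \<eta> z * \<phi> (x - z))"
      by (rule compact_support_lborel(2)[OF c2]) (use \<eta>z' in auto)
    finally show ?thesis .
  qed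
  have gr: "grad \<Phi> x = integral (cbox (-a) a) (\<lambda>z. \<eta> z *\<^sub>R G (x - z))" for x
    using convolution_has_derivative[OF \<eta> der G] by (intro grad_eqI) (simp add: alt[abs_def])
  have small: "norm w < e" if "\<eta> w \<noteq> 0" for w using \<eta>z[of w] that by linarith
  have "\<bar>\<Phi> x - \<phi> x\<bar> \<le> \<delta>" for x
  proof -
    have "norm (\<phi> (x - w) - \<phi> x) \<le> \<delta>" if "\<eta> w \<noteq> 0" for w
      using e1(2)[of w x] small[OF that] unfolding e_def by simp
    with \<phi> \<eta> \<eta>n \<eta>z' one
    have "norm (integral (cbox (-a) a) (\<lambda>z. \<eta> z *\<^sub>R \<phi> (x - z)) - \<phi> x) \<le> \<delta>"
      by (rule kernel_average_error[where F = \<phi> and \<eta> = \<eta> and x = x])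
    then show ?thesis by (simp add: alt)
  qed
  moreover have "norm (grad \<Phi> x - G x) \<le> \<delta>" for x
  proof -
    have "norm (G (x - w) - G x) \<le> \<delta>" if "\<eta> w \<noteq> 0" for w
      using e2(2)[of w x] small[OF that] unfolding e_def by simp
    with G \<eta> \<eta>n \<eta>z' one show ?thesis unfolding gr
      by (rule kernel_average_error[where F = G and \<eta> = \<eta> and x = x])
  qed
  moreover have "0 \<le> \<Phi> x" for x unfolding \<Phi>_def
    by (intro Henstock_Kurzweil_Integration.integral_nonneg integrable_continuous continuous_intros continuous_on_compose2[OF \<phi>] continuous_on_compose2[OF \<eta>])
       (use n \<eta>n in auto)
  moreover have "\<Phi> x = 0" if x: "x \<notin> cball c R" for x
  proof -
    have "\<eta> w * \<phi> (x - w) = 0" for w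
    proof (cases "e \<le> norm w")
      case False
      have "dist c x \<le> dist c (x - w) + dist (x - w) x" by (rule dist_triangle)
      then have "x - w \<notin> cball c r" using x False by (auto simp: e_def dist_norm)
      then show ?thesis using z by auto
    qed (use \<eta>z in auto)
    then show ?thesis unfolding alt by (simp only: Henstock_Kurzweil_Integration.integral_0)
  qed
  ultimately show ?thesis using smooth by blast
qed

section \<open>The p-flux and test functions of class C1\<close>

text \<open>The vector field whose divergence, at \<xi> = grad u, is the p-Laplacian of u. It is 0
  at the origin for every p.\<close>

definition p_flux :: "real \<Rightarrow> 'a::real_inner \<Rightarrow> 'a" where
  "p_flux p \<xi> = norm \<xi> powr (p - 2) *\<^sub>R \<xi>"

lemma norm_p_flux: "norm (p_flux p \<xi>) = norm \<xi> powr (p - 1)"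
  using powr_mult_base[of "norm \<xi>" "p - 2"] by (simp add: p_flux_def mult.commute)

text \<open>Only the origin is delicate, since the scalar factor is singular there when p < 2; but
  the flux has norm |\<xi>|^(p-1), which tends to 0 as p > 1.\<close>

lemma continuous_on_p_flux:
  assumes "p > 1" shows "continuous_on S (p_flux p)"
proof (intro continuous_at_imp_continuous_on ballI)
  fix x :: 'a
  show "isCont (p_flux p) x"
  proof (cases "x = 0")
    case False
    then show ?thesis unfolding p_flux_def[abs_def] by (intro continuous_intros) auto
  next
    case True
    have "continuous_on UNIV (\<lambda>x::'a. norm x powr (p - 1))"
      using assms by (intro continuous_on_powr' continuous_intros) auto
    then have "((\<lambda>x::'a. norm x powr (p - 1)) \<longlongrightarrow> norm (0::'a) powr (p - 1)) (at 0)"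
      unfolding continuous_on_def by (auto simp del: norm_zero)
    then have "((\<lambda>x::'a. norm (p_flux p x)) \<longlongrightarrow> 0) (at 0)" by (simp add: norm_p_flux)
    then have "(p_flux p \<longlongrightarrow> (0::'a)) (at 0)" by (rule tendsto_norm_zero_cancel)
    then show ?thesis using True by (simp add: isCont_def p_flux_def)
  qed
qed

text \<open>By Cauchy-Schwarz the difference of the two sides is at least (s^(p-1) - t^(p-1)) (s -
  t), where s and t are the two norms, and both factors have the same sign.\<close>

lemma p_flux_monotone:
  assumes "p > 1"
  shows "p_flux p \<eta> \<bullet> (\<xi> - \<eta>) \<le> p_flux p \<xi> \<bullet> (\<xi> - \<eta>)"
proof -
  define s t S T where "s = norm \<xi>" and "t = norm \<eta>" and "S = s powr (p - 2)" and "T = t powr (p - 2)"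
  have Ss: "S * s = s powr (p - 1)" "T * t = t powr (p - 1)"
    using powr_mult_base[of s "p - 2"] powr_mult_base[of t "p - 2"]
    by (auto simp: S_def T_def s_def t_def mult.commute)
  have "(S + T) * (\<xi> \<bullet> \<eta>) \<le> (S + T) * (s * t)"
    unfolding s_def t_def by (intro mult_left_mono norm_cauchy_schwarz) (auto simp: S_def T_def)
  moreover have "0 \<le> (S * s - T * t) * (s - t)"
    unfolding Ss using assms powr_mono2[of "p - 1" s t] powr_mono2[of "p - 1" t s]
    by (cases "s \<le> t") (auto simp: s_def t_def mult_nonpos_nonpos)
  ultimately have "0 \<le> S * s\<^sup>2 + T * t\<^sup>2 - (S + T) * (\<xi> \<bullet> \<eta>)"
    by (simp add: algebra_simps power2_eq_square)
  moreover have "p_flux p \<xi> \<bullet> (\<xi> - \<eta>) - p_flux p \<eta> \<bullet> (\<xi> - \<eta>) = S * s\<^sup>2 + T * t\<^sup>2 - (S + T) * (\<xi> \<bullet> \<eta>)"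
    by (simp add: p_flux_def S_def T_def s_def t_def algebra_simps inner_commute power2_norm_eq_inner)
  ultimately show ?thesis by linarith
qed

lemma smooth_fn_C1:
  fixes \<phi> :: "real^'n::finite \<Rightarrow> real"
  assumes "smooth_fn UNIV \<phi>"
  shows "(\<phi> has_derivative (\<lambda>h. grad \<phi> x \<bullet> h)) (at x)" "continuous_on UNIV (grad \<phi>)"
proof -
  from assms obtain g where g: "\<And>x. (\<phi> has_derivative (\<lambda>h. g x \<bullet> h)) (at x)"
    and gi: "\<And>i. smooth_fn UNIV (\<lambda>x. g x $ i)"
    by (cases rule: smooth_fn.cases) auto
  have gr: "grad \<phi> = g" using grad_eqI[OF g] by auto
  show "(\<phi> has_derivative (\<lambda>h. grad \<phi> x \<bullet> h)) (at x)" using g gr by simp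
  have "continuous_on UNIV (\<lambda>x. g x $ i)" for i
    using gi[of i] by (cases rule: smooth_fn.cases) auto
  then show "continuous_on UNIV (grad \<phi>)" unfolding gr by (rule continuous_on_vec_lambda_components)
qed

lemma test_fnI:
  fixes \<phi> :: "real^'n::finite \<Rightarrow> real"
  assumes "smooth_fn UNIV \<phi>" "compact K" "K \<subseteq> \<Omega>" "\<And>x. x \<notin> K \<Longrightarrow> \<phi> x = 0"
  shows "test_fn \<Omega> \<phi>"
proof -
  have "closure {x. \<phi> x \<noteq> 0} \<subseteq> K"
    using assms by (intro closure_minimal compact_imp_closed) auto
  moreover have "bounded {x. \<phi> x \<noteq> 0}"
    using assms by (intro bounded_subset[OF compact_imp_bounded]) auto
  ultimately show ?thesis unfolding test_fn_def using assms(1,3) by auto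
qed

lemma integrable_mult_bounded_continuous:
  fixes g :: "'a::euclidean_space \<Rightarrow> real"
  assumes g: "set_integrable lebesgue \<Omega> g" and \<phi>: "continuous_on UNIV \<phi>"
    and z: "\<And>x. x \<notin> cball c r \<Longrightarrow> \<phi> x = 0"
  shows "set_integrable lebesgue \<Omega> (\<lambda>x. g x * \<phi> x)"
proof -
  have "bounded (\<phi> ` cball c r)"
    by (intro compact_imp_bounded compact_continuous_image continuous_on_subset[OF \<phi>]) auto
  then obtain C where "\<And>x. x \<in> cball c r \<Longrightarrow> \<bar>\<phi> x\<bar> \<le> C" "C > 0"
    unfolding bounded_pos by (metis imageI real_norm_def)
  then have C: "\<bar>\<phi> x\<bar> \<le> C" for x by (cases "x \<in> cball c r") (auto simp: z)
  have m: "\<phi> \<in> borel_measurable lebesgue"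
    using borel_measurable_continuous_onI[OF \<phi>] by (simp add: measurable_completion)
  have g': "integrable lebesgue (\<lambda>x. indicator \<Omega> x * g x)" using g by (simp add: set_integrable_def)
  have "integrable lebesgue (\<lambda>x. (indicator \<Omega> x * g x) * \<phi> x)"
  proof (rule Bochner_Integration.integrable_bound[where f="\<lambda>x. C * (indicator \<Omega> x * g x)"])
    show "AE x in lebesgue. norm (indicator \<Omega> x * g x * \<phi> x) \<le> norm (C * (indicator \<Omega> x * g x))"
    proof (rule AE_I2)
      fix x
      show "norm (indicator \<Omega> x * g x * \<phi> x) \<le> norm (C * (indicator \<Omega> x * g x))"
        using mult_left_mono[OF C[of x] abs_ge_zero[of "indicator \<Omega> x * g x"]] \<open>C > 0\<close>
        by (simp add: abs_mult mult_ac)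
    qed
  qed (use g' m in auto)
  then show ?thesis by (simp add: set_integrable_def mult.assoc)
qed

lemma set_integrable_inner_compact_support:
  fixes B :: "'a::euclidean_space \<Rightarrow> 'b::euclidean_space"
  assumes B: "continuous_on K B" and H: "continuous_on K H" and K: "compact K" "K \<subseteq> \<Omega>"
    and z: "\<And>x. x \<notin> K \<Longrightarrow> H x = 0"
  shows "set_integrable lebesgue \<Omega> (\<lambda>x. B x \<bullet> H x)"
proof -
  have "integrable lborel (\<lambda>x. indicator K x *\<^sub>R (B x \<bullet> H x))"
    by (intro borel_integrable_compact continuous_intros B H K)
  moreover have "(\<lambda>x. indicator K x *\<^sub>R (B x \<bullet> H x)) = (\<lambda>x. indicator \<Omega> x *\<^sub>R (B x \<bullet> H x))"
    using K z by (auto simp: indicator_def fun_eq_iff)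
  ultimately have "integrable lborel (\<lambda>x. indicator \<Omega> x *\<^sub>R (B x \<bullet> H x))" by simp
  then show ?thesis
    unfolding set_integrable_def using borel_measurable_integrable integrable_completion by blast
qed

text \<open>Mollify the test function and pass to the limit. All supports lie in
  \<open>cball c R\<close>, where the flux of \<open>u\<close> is bounded, and
  \<open>\<rho> f(u)\<close> is integrable, so both sides of the weak inequality are continuous
  under uniform convergence of function and gradient.\<close>

lemma supersol_C1_test:
  fixes u :: "real^'n::finite \<Rightarrow> real"
  assumes p: "p > 1" and u: "pos_C1_weak_supersol p a f \<Omega> \<rho> lam u"
    and K: "cball c R \<subseteq> \<Omega>" and r: "r < R"
    and der: "\<And>x. (\<phi> has_derivative (\<lambda>h. G x \<bullet> h)) (at x)" and G: "continuous_on UNIV G"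
    and z: "\<And>x. x \<notin> cball c r \<Longrightarrow> \<phi> x = 0" and n: "\<And>x. 0 \<le> \<phi> x"
  shows "lam * set_lebesgue_integral lebesgue \<Omega> (\<lambda>x. \<rho> x * f (u x) * \<phi> x)
    \<le> set_lebesgue_integral lebesgue \<Omega> (\<lambda>x. p_flux p (grad u x) \<bullet> G x)"
proof -
  obtain gu where gu: "continuous_on \<Omega> gu" "\<And>x. x \<in> \<Omega> \<Longrightarrow> (u has_derivative (\<lambda>h. gu x \<bullet> h)) (at x)"
    using u unfolding pos_C1_weak_supersol_def C1_on_def by blast
  have gr: "grad u x = gu x" if "x \<in> \<Omega>" for x using grad_eqI[OF gu(2)[OF that]] .
  define B where "B x = p_flux p (grad u x)" for x
  have "continuous_on \<Omega> (\<lambda>x. p_flux p (gu x))"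
    by (rule continuous_on_compose2[OF continuous_on_p_flux[OF p] gu(1) subset_UNIV])
  then have "continuous_on \<Omega> B" by (rule continuous_on_eq) (simp add: B_def gr)
  then have B: "continuous_on (cball c R) B" using K continuous_on_subset by blast
  have "bounded (B ` cball c R)" by (intro compact_imp_bounded compact_continuous_image B) auto
  then obtain M where M: "\<And>x. x \<in> cball c R \<Longrightarrow> norm (B x) \<le> M" "M > 0"
    unfolding bounded_pos by (metis imageI)
  have si: "set_integrable lebesgue \<Omega> (\<lambda>x. \<rho> x * f (u x))"
    and weak: "\<And>\<phi>. test_fn \<Omega> \<phi> \<Longrightarrow> (\<forall>x. 0 \<le> \<phi> x) \<Longrightarrow>
        lam * set_lebesgue_integral lebesgue \<Omega> (\<lambda>x. \<rho> x * f (u x) * \<phi> x)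
        \<le> set_lebesgue_integral lebesgue \<Omega> (\<lambda>x. B x \<bullet> grad \<phi> x)"
    using u unfolding pos_C1_weak_supersol_def B_def p_flux_def by auto
  have zR: "\<phi> x = 0" if "x \<notin> cball c R" for x using that r by (intro z) auto
  have Gz: "G x = 0" if "x \<notin> cball c R" for x
    using has_derivative_vanishes_off_closed[OF der closed_cball zR that] .
  have \<phi>: "continuous_on UNIV \<phi>" using der by (rule has_derivative_at_imp_continuous_on)
  define I1 where "I1 = set_lebesgue_integral lebesgue \<Omega> (\<lambda>x. B x \<bullet> G x)"
  define I2 where "I2 = set_lebesgue_integral lebesgue \<Omega> (\<lambda>x. \<rho> x * f (u x) * \<phi> x)"
  define V where "V = measure lebesgue (cball c R)"
  define L where "L = integral\<^sup>L lebesgue (\<lambda>x. norm (indicator \<Omega> x *\<^sub>R (\<rho> x * f (u x))))"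
  have L: "integrable lebesgue (\<lambda>x. norm (indicator \<Omega> x *\<^sub>R (\<rho> x * f (u x))))"
    using si unfolding set_integrable_def by (rule integrable_norm)
  \<comment> \<open>The error is linear in \<open>\<delta>\<close>: the flux side contributes its
    bound \<open>M\<close> times the volume \<open>V\<close>, the source side |lam| times the L1
    norm \<open>L\<close> of \<open>\<rho> f(u)\<close>.\<close>
  have key: "lam * I2 \<le> I1 + \<delta> * (M * V + \<bar>lam\<bar> * L)" if d: "\<delta> > 0" for \<delta>
  proof -
    obtain \<Phi> where S: "smooth_fn UNIV \<Phi>" and \<Phi>n: "\<forall>x. 0 \<le> \<Phi> x" and \<Phi>z: "\<And>x. x \<notin> cball c R \<Longrightarrow> \<Phi> x = 0"
      and e1: "\<And>x. \<bar>\<Phi> x - \<phi> x\<bar> \<le> \<delta>" and e2: "\<And>x. norm (grad \<Phi> x - G x) \<le> \<delta>"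
      using C1_mollification[OF der G z n r d] by blast
    have \<Phi>: "continuous_on UNIV \<Phi>" using smooth_fn_C1(1)[OF S] by (rule has_derivative_at_imp_continuous_on)
    have g\<Phi>: "continuous_on (cball c R) (grad \<Phi>)" using smooth_fn_C1(2)[OF S] continuous_on_subset by blast
    have g\<Phi>z: "grad \<Phi> x = 0" if "x \<notin> cball c R" for x
      using has_derivative_vanishes_off_closed[OF smooth_fn_C1(1)[OF S] closed_cball \<Phi>z that] .
    have "test_fn \<Omega> \<Phi>" using S _ K \<Phi>z by (rule test_fnI) auto
    from weak[OF this \<Phi>n]
    have w: "lam * set_lebesgue_integral lebesgue \<Omega> (\<lambda>x. \<rho> x * f (u x) * \<Phi> x)
        \<le> set_lebesgue_integral lebesgue \<Omega> (\<lambda>x. B x \<bullet> grad \<Phi> x)" .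
    have i1: "set_integrable lebesgue \<Omega> (\<lambda>x. B x \<bullet> grad \<Phi> x)"
      by (rule set_integrable_inner_compact_support[OF B g\<Phi> _ K g\<Phi>z]) auto
    have i2: "set_integrable lebesgue \<Omega> (\<lambda>x. B x \<bullet> G x)"
      by (rule set_integrable_inner_compact_support[OF B _ _ K Gz]) (auto intro: continuous_on_subset[OF G])
    have "set_lebesgue_integral lebesgue \<Omega> (\<lambda>x. B x \<bullet> grad \<Phi> x) - I1
       = integral\<^sup>L lebesgue (\<lambda>x. indicator \<Omega> x *\<^sub>R (B x \<bullet> grad \<Phi> x - B x \<bullet> G x))"
      using set_integral_diff(2)[OF i1 i2] unfolding I1_def by (simp add: set_lebesgue_integral_def)
    also have "\<dots> \<le> integral\<^sup>L lebesgue (\<lambda>x. indicator (cball c R) x *\<^sub>R (M * \<delta>))"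
    proof (rule integral_mono)
      show "integrable lebesgue (\<lambda>x. indicator \<Omega> x *\<^sub>R (B x \<bullet> grad \<Phi> x - B x \<bullet> G x))"
        using set_integral_diff(1)[OF i1 i2] by (simp add: set_integrable_def)
      show "integrable lebesgue (\<lambda>x. indicator (cball c R) x *\<^sub>R (M * \<delta>))"
        by (intro integrable_scaleR_left integrable_real_indicator) (use emeasure_bounded_finite[OF bounded_cball, of c R] in auto)
      fix x
      show "indicator \<Omega> x *\<^sub>R (B x \<bullet> grad \<Phi> x - B x \<bullet> G x) \<le> indicator (cball c R) x *\<^sub>R (M * \<delta>)"
      proof (cases "x \<in> cball c R")
        case True
        have "B x \<bullet> (grad \<Phi> x - G x) \<le> norm (B x) * norm (grad \<Phi> x - G x)" by (rule norm_cauchy_schwarz)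
        also have "\<dots> \<le> M * \<delta>" using M(1)[OF True] e2[of x] by (intro mult_mono) (use M(2) in auto)
        finally show ?thesis using True K by (auto simp: inner_diff_right)
      qed (auto simp: Gz g\<Phi>z)
    qed
    also have "\<dots> = \<delta> * (M * V)" by (simp add: V_def)
    finally have A: "set_lebesgue_integral lebesgue \<Omega> (\<lambda>x. B x \<bullet> grad \<Phi> x) \<le> I1 + \<delta> * (M * V)" by simp
    have j1: "set_integrable lebesgue \<Omega> (\<lambda>x. \<rho> x * f (u x) * \<Phi> x)"
      by (rule integrable_mult_bounded_continuous[OF si \<Phi> \<Phi>z])
    have j2: "set_integrable lebesgue \<Omega> (\<lambda>x. \<rho> x * f (u x) * \<phi> x)"
      by (rule integrable_mult_bounded_continuous[OF si \<phi> z])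
    have "\<bar>set_lebesgue_integral lebesgue \<Omega> (\<lambda>x. \<rho> x * f (u x) * \<Phi> x) - I2\<bar>
       = norm (integral\<^sup>L lebesgue (\<lambda>x. indicator \<Omega> x *\<^sub>R (\<rho> x * f (u x) * \<Phi> x - \<rho> x * f (u x) * \<phi> x)))"
      using set_integral_diff(2)[OF j1 j2] unfolding I2_def by (simp add: set_lebesgue_integral_def)
    also have "\<dots> \<le> integral\<^sup>L lebesgue (\<lambda>x. \<delta> * norm (indicator \<Omega> x *\<^sub>R (\<rho> x * f (u x))))"
    proof (rule Bochner_Integration.integral_norm_bound_integral)
      show "integrable lebesgue (\<lambda>x. indicator \<Omega> x *\<^sub>R (\<rho> x * f (u x) * \<Phi> x - \<rho> x * f (u x) * \<phi> x))"
        using set_integral_diff(1)[OF j1 j2] by (simp add: set_integrable_def)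
      show "integrable lebesgue (\<lambda>x. \<delta> * norm (indicator \<Omega> x *\<^sub>R (\<rho> x * f (u x))))"
        using L by simp
      fix x
      show "norm (indicator \<Omega> x *\<^sub>R (\<rho> x * f (u x) * \<Phi> x - \<rho> x * f (u x) * \<phi> x))
         \<le> \<delta> * norm (indicator \<Omega> x *\<^sub>R (\<rho> x * f (u x)))"
      proof -
        have "\<rho> x * f (u x) * \<Phi> x - \<rho> x * f (u x) * \<phi> x = \<rho> x * f (u x) * (\<Phi> x - \<phi> x)"
          by (simp add: right_diff_distrib)
        then show ?thesis using mult_left_mono[OF e1[of x], of "\<bar>\<rho> x * f (u x)\<bar>"]
          by (simp add: indicator_def abs_mult mult_ac)
      qed
    qed
    also have "\<dots> = \<delta> * L" by (simp add: L_def)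
    finally have C: "\<bar>set_lebesgue_integral lebesgue \<Omega> (\<lambda>x. \<rho> x * f (u x) * \<Phi> x) - I2\<bar> \<le> \<delta> * L" .
    define I2' where "I2' = set_lebesgue_integral lebesgue \<Omega> (\<lambda>x. \<rho> x * f (u x) * \<Phi> x)"
    have "lam * (I2 - I2') \<le> \<bar>lam\<bar> * \<bar>I2' - I2\<bar>" by (metis abs_ge_self abs_minus_commute abs_mult)
    also have "\<dots> \<le> \<bar>lam\<bar> * (\<delta> * L)" using C unfolding I2'_def by (intro mult_left_mono) auto
    finally show ?thesis using w A unfolding I2'_def by (simp add: algebra_simps)
  qed
  have "lam * I2 \<le> I1 + x" if "x > 0" for x
  proof -
    \<comment> \<open>A positive upper bound of the error constant, so that
      \<open>\<delta> = x / Q\<close> is admissible and leaves an error of at most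
      \<open>x\<close>.\<close>
    define Q where "Q = \<bar>M * V + \<bar>lam\<bar> * L\<bar> + 1"
    have Q: "Q > 0" "M * V + \<bar>lam\<bar> * L \<le> Q" unfolding Q_def by linarith+
    have "lam * I2 \<le> I1 + (x / Q) * (M * V + \<bar>lam\<bar> * L)"
      by (rule key) (use that Q in auto)
    also have "\<dots> \<le> I1 + (x / Q) * Q" using that Q by (intro add_left_mono mult_left_mono) auto
    finally show ?thesis using Q by simp
  qed
  then have "lam * I2 \<le> I1" by (rule field_le_epsilon)
  then show ?thesis unfolding I1_def I2_def B_def .
qed

text \<open>The weak form of div (k(x) x) = (N + \<alpha>) k(x) for a weight k of degree \<alpha>.
  Substituting t x for x shows that t^(N + \<alpha>) times the integral of k(x) \<psi>(t x) does not
  depend on t; differentiate this at t = 1.\<close>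

lemma homogeneous_weight_scaling_identity:
  fixes \<psi> :: "real^'n::finite \<Rightarrow> real"
  assumes k: "continuous_on UNIV k" and hom: "\<And>t x. t > 0 \<Longrightarrow> k (t *\<^sub>R x) = t powr \<alpha> * k x"
    and der: "\<And>x. (\<psi> has_derivative (\<lambda>h. G x \<bullet> h)) (at x)" and G: "continuous_on UNIV G"
    and z: "\<And>x. x \<notin> cball 0 r \<Longrightarrow> \<psi> x = 0"
  shows "integral\<^sup>L lborel (\<lambda>x. k x * (x \<bullet> G x)) = - (real CARD('n) + \<alpha>) * integral\<^sup>L lborel (\<lambda>x. k x * \<psi> x)"
proof -
  have \<psi>: "continuous_on UNIV \<psi>" using der by (rule has_derivative_at_imp_continuous_on)
  have Gz: "G x = 0" if "x \<notin> cball 0 r" for x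
    using has_derivative_vanishes_off_closed[OF der closed_cball z that] .
  \<comment> \<open>Radius \<open>2 * \<bar>r\<bar>\<close> makes a single box contain the supports
    of the dilates \<psi>(t x) for all t > 1/2, a neighbourhood of 1. The absolute value covers
    negative \<open>r\<close>.\<close>
  obtain b where b: "cball (0::real^'n) (2 * \<bar>r\<bar>) \<subseteq> cbox (-b) b" using bounded_subset_cbox_symmetric[OF bounded_cball] by blast
  have sub: "t *\<^sub>R x \<notin> cball 0 r" if "x \<notin> cbox (-b) b" "t > 1/2" for t and x :: "real^'n"
  proof -
    have "norm x > 2 * \<bar>r\<bar>" using that b by (auto simp: subset_iff not_le[symmetric])
    moreover have "t * norm x \<ge> (1/2) * norm x" using that by (intro mult_right_mono) auto
    ultimately have "t * norm x > r" by linarith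
    then show ?thesis using that by simp
  qed
  have z1: "\<psi> x = 0" "G x = 0" if "x \<notin> cbox (-b) b" for x
    using sub[OF that, of 1] by (simp_all add: z Gz)
  define s where "s = real CARD('n) + \<alpha>"
  define J where "J t = integral (cbox (-b) b) (\<lambda>y. k y * \<psi> (t *\<^sub>R y))" for t :: real
  define J' where "J' = integral (cbox (-b) b) (\<lambda>y. k y * (G (1 *\<^sub>R y) \<bullet> y))"
  have "(J has_derivative (\<lambda>h. J' \<bullet> h)) (at 1)"
    unfolding J_def J'_def
  proof (rule leibniz_gradient)
    fix t :: real and y :: "real^'n"
    have "((\<lambda>t. t *\<^sub>R y) has_derivative (\<lambda>h. h *\<^sub>R y)) (at t)" by (auto intro!: derivative_eq_intros)
    from has_derivative_compose[OF this der]
    show "((\<lambda>t. k y * \<psi> (t *\<^sub>R y)) has_derivative (\<lambda>h. (k y * (G (t *\<^sub>R y) \<bullet> y)) \<bullet> h)) (at t)"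
      by (auto intro!: derivative_eq_intros)
    show "continuous_on UNIV (\<lambda>z. k (snd z) * (G (fst z *\<^sub>R snd z) \<bullet> snd z))"
      by (intro continuous_intros continuous_on_compose2[OF k] continuous_on_compose2[OF G]) auto
    show "continuous_on (cbox (- b) b) (\<lambda>y. k y * \<psi> (t *\<^sub>R y))"
      by (intro continuous_intros continuous_on_compose2[OF k] continuous_on_compose2[OF \<psi>]) auto
  qed
  then have Jd: "(J has_real_derivative J') (at 1)"
    by (simp add: has_field_derivative_def mult_commute_abs)
  have kp: "continuous_on UNIV (\<lambda>x. k x * \<psi> x)" by (intro continuous_intros k \<psi>)
  have J_eq: "t powr s * J t = J 1" if t: "t > 1/2" for t
  proof -
    have ct: "continuous_on UNIV (\<lambda>y. k y * \<psi> (t *\<^sub>R y))"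
      by (intro continuous_intros k continuous_on_compose2[OF \<psi>]) auto
    have L: "integral\<^sup>L lborel (\<lambda>y. k y * \<psi> (t *\<^sub>R y)) = J t"
      unfolding J_def by (rule compact_support_lborel(2)[OF ct]) (use z[OF sub[OF _ t]] in simp)
    have L1: "integral\<^sup>L lborel (\<lambda>y. k y * \<psi> y) = J 1"
      unfolding J_def using compact_support_lborel(2)[OF kp, of "-b" b] z1 by simp
    have "J 1 = t ^ CARD('n) * integral\<^sup>L lborel (\<lambda>y. t powr \<alpha> * (k y * \<psi> (t *\<^sub>R y)))"
      using lborel_integral_affine[of "\<lambda>y. k y * \<psi> y" t 0] borel_measurable_continuous_onI[OF kp] t
      unfolding L1 by (simp add: hom mult.assoc)
    also have "\<dots> = t ^ CARD('n) * (t powr \<alpha> * J t)" by (simp add: L)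
    also have "\<dots> = t powr s * J t" using t by (simp add: s_def powr_add powr_realpow)
    finally show ?thesis by simp
  qed
  have "((\<lambda>t. t powr s * J t) has_real_derivative s * J 1 + J') (at 1)"
    by (auto intro!: derivative_eq_intros Jd)
  then have "((\<lambda>t. J 1) has_real_derivative s * J 1 + J') (at 1)"
    by (rule has_field_derivative_transform_within_open[where S="{1/2<..}"]) (auto simp: J_eq)
  then have e: "s * J 1 + J' = 0" using DERIV_unique DERIV_const by blast
  have "integral\<^sup>L lborel (\<lambda>x. k x * (x \<bullet> G x)) = J'"
    unfolding J'_def
  proof -
    have "continuous_on UNIV (\<lambda>x. k x * (x \<bullet> G x))" by (intro continuous_intros k G)
    from compact_support_lborel(2)[OF this, of "-b" b] z1
    show "integral\<^sup>L lborel (\<lambda>x. k x * (x \<bullet> G x)) = integral (cbox (-b) b) (\<lambda>y. k y * (G (1 *\<^sub>R y) \<bullet> y))"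
      by (simp add: inner_commute)
  qed
  moreover have "integral\<^sup>L lborel (\<lambda>x. k x * \<psi> x) = J 1"
    unfolding J_def using compact_support_lborel(2)[OF kp, of "-b" b] z1 by simp
  ultimately show ?thesis using e by (simp add: s_def algebra_simps)
qed

lemma homogeneous_weight_scaling_identity_centered:
  fixes \<psi> :: "real^'n::finite \<Rightarrow> real"
  assumes k: "continuous_on UNIV k" and hom: "\<And>t x. t > 0 \<Longrightarrow> k (t *\<^sub>R x) = t powr \<alpha> * k x"
    and der: "\<And>x. (\<psi> has_derivative (\<lambda>h. G x \<bullet> h)) (at x)" and G: "continuous_on UNIV G"
    and z: "\<And>x. x \<notin> cball c r \<Longrightarrow> \<psi> x = 0"
  shows "integral\<^sup>L lborel (\<lambda>x. k (x - c) * ((x - c) \<bullet> G x))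
    = - (real CARD('n) + \<alpha>) * integral\<^sup>L lborel (\<lambda>x. k (x - c) * \<psi> x)"
proof -
  have \<psi>: "continuous_on UNIV \<psi>" using der by (rule has_derivative_at_imp_continuous_on)
  have kc: "continuous_on UNIV (\<lambda>x. k (x - c))"
    by (intro continuous_on_compose2[OF k] continuous_intros) auto
  have "((\<lambda>x. c + x) has_derivative (\<lambda>h. h)) (at x)" for x by (auto intro!: derivative_eq_intros)
  from has_derivative_compose[OF this der]
  have d': "((\<lambda>x. \<psi> (c + x)) has_derivative (\<lambda>h. G (c + x) \<bullet> h)) (at x)" for x .
  have "integral\<^sup>L lborel (\<lambda>x. k x * (x \<bullet> G (c + x)))
    = - (real CARD('n) + \<alpha>) * integral\<^sup>L lborel (\<lambda>x. k x * \<psi> (c + x))"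
  proof (rule homogeneous_weight_scaling_identity[OF k hom d'])
    show "continuous_on UNIV (\<lambda>x. G (c + x))"
      by (intro continuous_on_compose2[OF G] continuous_intros) auto
    show "\<psi> (c + x) = 0" if "x \<notin> cball 0 r" for x using that by (intro z) (auto simp: dist_norm)
  qed
  moreover have "integral\<^sup>L lborel (\<lambda>x. k (x - c) * ((x - c) \<bullet> G x)) = integral\<^sup>L lborel (\<lambda>x. k x * (x \<bullet> G (c + x)))"
  proof -
    have "continuous_on UNIV (\<lambda>x. k (x - c) * ((x - c) \<bullet> G x))" by (intro continuous_intros kc G)
    from lborel_integral_affine[OF borel_measurable_continuous_onI[OF this], of 1 c]
    show ?thesis by simp
  qed
  moreover have "integral\<^sup>L lborel (\<lambda>x. k (x - c) * \<psi> x) = integral\<^sup>L lborel (\<lambda>x. k x * \<psi> (c + x))"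
  proof -
    have "continuous_on UNIV (\<lambda>x. k (x - c) * \<psi> x)" by (intro continuous_intros kc \<psi>)
    from lborel_integral_affine[OF borel_measurable_continuous_onI[OF this], of 1 c]
    show ?thesis by simp
  qed
  ultimately show ?thesis by simp
qed

section \<open>The comparison argument\<close>

lemma condC_open: "open {s. 0 < s \<and> ereal s < a}"
  by (intro open_Collect_conj open_Collect_less continuous_intros continuous_on_ereal)

text \<open>The primitive is F s = integral of the integrand over [0, s]. Finiteness of the norm
  makes this meaningful even if the integrand is singular at 0, as when f 0 = 0, and the integral
  over the whole range bounds F.\<close>

lemma Fnorm_primitive_exists:
  assumes p: "p > 1" and C: "condC a f" and fin: "Fnorm p a f \<noteq> \<infinity>"
  shows "\<exists>F. \<forall>s. 0 < s \<and> ereal s < a \<longrightarrow>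
     (F has_real_derivative f s powr (-1 / (p - 1))) (at s) \<and> 0 \<le> F s \<and> F s \<le> enn2real (Fnorm p a f)"
proof -
  define D where "D = {s. 0 < s \<and> ereal s < a}"
  define g where "g s = f s powr (-1 / (p - 1))" for s
  \<comment> \<open>Extension by zero yields one integrable function on the line, whether
    \<open>a\<close> is finite or not.\<close>
  define h where "h s = indicat_real D s *\<^sub>R g s" for s
  have D: "open D" unfolding D_def by (rule condC_open)
  have "continuous_on {s. 0 \<le> s \<and> ereal s < a} f"
    using C unfolding condC_def continuous_on_eq_continuous_within using DERIV_continuous by blast
  then have fc: "continuous_on D f" by (rule continuous_on_subset) (auto simp: D_def)
  have fpos: "f s > 0" if "s \<in> D" for s using that C by (auto simp: D_def condC_def)
  have gc: "continuous_on D g" unfolding g_def using fpos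
    by (intro continuous_intros fc) (auto simp: less_imp_neq[symmetric])
  have hm: "h \<in> borel_measurable borel"
    unfolding h_def using D gc by (intro borel_measurable_continuous_on_indicator) auto
  have h0: "h s \<ge> 0" for s by (simp add: h_def g_def)
  have eq: "(\<integral>\<^sup>+ s. ennreal (h s) \<partial>lebesgue) = Fnorm p a f"
    unfolding Fnorm_def by (intro nn_integral_cong) (auto simp: h_def g_def D_def indicator_def)
  have hi: "integrable lebesgue h"
  proof (rule integrableI_nonneg)
    show "h \<in> borel_measurable lebesgue" using hm by (simp add: measurable_completion)
    show "AE x in lebesgue. 0 \<le> h x" using h0 by simp
    show "(\<integral>\<^sup>+ s. ennreal (h s) \<partial>lebesgue) < \<infinity>" using eq fin by (simp add: top.not_eq_extremum)
  qed
  have "integral\<^sup>L lebesgue h = enn2real (Fnorm p a f)"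
    using integral_eq_nn_integral[of h lebesgue] h0 hi eq by simp
  then have hI: "(h has_integral enn2real (Fnorm p a f)) UNIV"
    using has_integral_integral_lebesgue[OF hi] by simp
  have hint: "h integrable_on {x..y}" for x y
    using integrable_on_subcbox[OF has_integral_integrable[OF hI], of x y] by simp
  define F where "F s = integral {0..s} h" for s
  have "(F has_real_derivative g s) (at s) \<and> 0 \<le> F s \<and> F s \<le> enn2real (Fnorm p a f)" if s: "s \<in> D" for s
  proof (intro conjI)
    have "continuous_on D h" using gc by (rule continuous_on_eq) (simp add: h_def)
    then have hc: "isCont h s" using D s continuous_on_eq_continuous_at by blast
    \<comment> \<open>The point \<open>s + 1\<close> only serves to put \<open>s\<close> in the
      interior of the interval; it may exceed \<open>a\<close>, where \<open>h\<close> is 0.\<close>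
    have "(F has_vector_derivative h s) (at s within {0..s + 1})"
      using integral_has_vector_derivative_continuous_at[OF hint[of 0 "s + 1"], of s "{}"] s
        continuous_at_imp_continuous_at_within[OF hc]
      unfolding F_def by (simp add: D_def)
    moreover have "at s within {0..s + 1} = at s"
      using s by (intro at_within_interior) (auto simp: D_def)
    ultimately show "(F has_real_derivative g s) (at s)"
      using s by (simp add: has_real_derivative_iff_has_vector_derivative h_def)
    show "0 \<le> F s" unfolding F_def using h0 by (intro Henstock_Kurzweil_Integration.integral_nonneg hint)
    have "F s \<le> integral UNIV h" unfolding F_def
      using h0 hI by (intro integral_subset_le hint) auto
    then show "F s \<le> enn2real (Fnorm p a f)" using hI integral_unique by metis
  qed
  then show ?thesis unfolding D_def g_def by blast
qed

text \<open>The gradient of a power of the norm is itself a flux field, with exponent q, so the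
  p-flux of the barrier gradient can be computed by composing two fluxes. At the origin the
  difference quotient has size |y|^(q-1), hence q > 1.\<close>

lemma norm_powr_has_derivative:
  fixes y :: "'a::real_inner"
  assumes q: "q > 1"
  shows "((\<lambda>y. norm y powr q) has_derivative (\<lambda>h. q * (p_flux q y \<bullet> h))) (at y)"
proof (cases "y = 0")
  case False
  have 1: "((\<lambda>t. t powr q) has_derivative (*) (q * norm y powr (q - 1))) (at (norm y))"
    using False has_real_derivative_powr[of "norm y" q] by (simp add: has_field_derivative_def)
  have 2: "(norm has_derivative (\<lambda>h. sgn y \<bullet> h)) (at y)"
    using False has_derivative_norm[of y] by (simp add: inner_commute)
  have "norm y powr (q - 1) * (sgn y \<bullet> h) = p_flux q y \<bullet> h" for h
    using False powr_mult_base[of "norm y" "q - 2"]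
    by (auto simp: p_flux_def sgn_div_norm field_simps)
  then show ?thesis
    by (intro has_derivative_eq_rhs[OF has_derivative_compose[OF 2 1]]) (auto simp: mult.assoc)
next
  case True
  have "continuous_on UNIV (\<lambda>x::'a. norm x powr (q - 1))"
    using q by (intro continuous_on_powr' continuous_intros) auto
  then have "((\<lambda>x::'a. norm x powr (q - 1)) \<longlongrightarrow> norm (0::'a) powr (q - 1)) (at 0)"
    unfolding continuous_on_def by (auto simp del: norm_zero)
  then have "((\<lambda>x::'a. norm x powr (q - 1)) \<longlongrightarrow> 0) (at 0)" by simp
  moreover have "norm x powr (q - 1) = norm x powr q / norm x" for x :: 'a
    by (cases "x = 0") (auto simp: powr_diff)
  ultimately have "((\<lambda>x::'a. norm x powr q / norm x) \<longlongrightarrow> 0) (at 0)" by simp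
  then show ?thesis using True
    by (simp add: has_derivative_at p_flux_def bounded_linear_zero)
qed

text \<open>Squaring removes the kink of the positive part, which gives a test function with
  continuous gradient.\<close>

lemma max_0_square_has_real_derivative:
  "((\<lambda>t::real. (max 0 t)\<^sup>2) has_real_derivative 2 * max 0 t) (at t)"
proof -
  consider "t > 0" | "t < 0" | "t = 0" by linarith
  then show ?thesis
  proof cases
    case 1
    have "((\<lambda>t. t\<^sup>2) has_real_derivative 2 * max 0 t) (at t)"
      using 1 by (auto intro!: derivative_eq_intros)
    then show ?thesis
      by (rule has_field_derivative_transform_within_open[where S="{0<..}"]) (use 1 in auto)
  next
    case 2
    have "((\<lambda>t. 0) has_real_derivative 2 * max 0 t) (at t)" using 2 by simp
    then show ?thesis
      by (rule has_field_derivative_transform_within_open[where S="{..<0}"]) (use 2 in auto)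
  next
    case 3
    have "((\<lambda>h::real. max 0 h) \<longlongrightarrow> max 0 0) (at 0)" by (intro tendsto_intros)
    then have "((\<lambda>h::real. max 0 h) \<longlongrightarrow> 0) (at 0)" by simp
    moreover have "(max 0 (0 + h))\<^sup>2 - (max 0 0)\<^sup>2 = max 0 h * h" for h :: real
      by (auto simp: max_def power2_eq_square)
    moreover have "\<forall>\<^sub>F h in at (0::real). max 0 h = max 0 h * h / h"
      by (auto simp: eventually_at_filter)
    ultimately have "((\<lambda>h::real. ((max 0 (0 + h))\<^sup>2 - (max 0 0)\<^sup>2) / h) \<longlongrightarrow> 0) (at 0)"
      by (simp only: Lim_transform_eventually)
    then show ?thesis using 3 by (simp add: DERIV_def)
  qed
qed

text \<open>The open sets \<open>B\<close> and \<open>- K\<close> cover the space, and the extended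
  function is 0 on the second one.\<close>

lemma C1_zero_extension:
  fixes \<phi> :: "'a::real_inner \<Rightarrow> real"
  assumes B: "open B" and K: "closed K" "K \<subseteq> B"
    and der: "\<And>x. x \<in> B \<Longrightarrow> (\<phi> has_derivative (\<lambda>h. G x \<bullet> h)) (at x)" and G: "continuous_on B G"
    and z: "\<And>x. x \<in> B - K \<Longrightarrow> \<phi> x = 0"
  shows "((\<lambda>x. if x \<in> B then \<phi> x else 0) has_derivative (\<lambda>h. (if x \<in> B then G x else 0) \<bullet> h)) (at x)"
    and "continuous_on UNIV (\<lambda>x. if x \<in> B then G x else 0)"
proof -
  have der': "((\<lambda>x. if x \<in> B then \<phi> x else 0) has_derivative (\<lambda>h. G x \<bullet> h)) (at x)" if "x \<in> B" for x
    by (rule has_derivative_transform_within_open[OF der[OF that] B that]) auto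
  have Gz: "G x = 0" if "x \<in> B - K" for x
    by (rule has_derivative_vanishes_off_closed[OF der' K(1)]) (use that z in auto)
  show "((\<lambda>x. if x \<in> B then \<phi> x else 0) has_derivative (\<lambda>h. (if x \<in> B then G x else 0) \<bullet> h)) (at x)"
  proof (cases "x \<in> B")
    case False
    have "((\<lambda>x. if x \<in> B then \<phi> x else 0) has_derivative (\<lambda>h. 0)) (at x)"
      by (rule has_derivative_transform_within_open[OF has_derivative_const, of "- K"])
         (use False K z in auto)
    then show ?thesis using False by simp
  qed (use der' in auto)
  have "continuous_on (B \<union> - K) (\<lambda>x. if x \<in> B then G x else 0)"
  proof (rule continuous_on_open_Un)
    show "continuous_on B (\<lambda>x. if x \<in> B then G x else 0)" using G by (rule continuous_on_eq) auto
    show "continuous_on (- K) (\<lambda>x. if x \<in> B then G x else 0)"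
      using continuous_on_const by (rule continuous_on_eq) (use Gz in auto)
  qed (use B K in auto)
  moreover have "B \<union> - K = UNIV" using K by auto
  ultimately show "continuous_on UNIV (\<lambda>x. if x \<in> B then G x else 0)" by simp
qed

text \<open>Since \<open>0 powr 0 = 0\<close>, the constant weight needs a separate case.\<close>

definition hom_weight :: "real \<Rightarrow> 'a::real_normed_vector \<Rightarrow> real" where
  "hom_weight \<alpha> y = (if \<alpha> = 0 then 1 else norm y powr \<alpha>)"

lemma hom_weight_scaleR: "t > 0 \<Longrightarrow> hom_weight \<alpha> (t *\<^sub>R y) = t powr \<alpha> * hom_weight \<alpha> y"
  by (simp add: hom_weight_def powr_mult)

lemma continuous_on_hom_weight: "\<alpha> \<ge> 0 \<Longrightarrow> continuous_on S (hom_weight \<alpha>)"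
  unfolding hom_weight_def[abs_def]
  by (cases "\<alpha> = 0") (simp, simp, intro continuous_on_powr' continuous_intros, auto)

lemma p_flux_scaleR: "p_flux p (s *\<^sub>R \<xi>) = (\<bar>s\<bar> powr (p - 2) * s) *\<^sub>R p_flux p \<xi>"
  by (simp add: p_flux_def powr_mult)

text \<open>The exponent of the barrier is chosen such that its flux is the field \<open>\<kappa> |y|\<^sup>\<alpha> y\<close>.\<close>

lemma p_flux_barrier_gradient:
  assumes p: "p > 1" and \<alpha>: "\<alpha> \<ge> 0" and \<kappa>: "\<kappa> > 0" and q: "q = (\<alpha> + p) / (p - 1)"
  shows "p_flux p (- (\<kappa> powr (1 / (p - 1))) *\<^sub>R p_flux q y) = - (\<kappa> * hom_weight \<alpha> y) *\<^sub>R y"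
proof (cases "y = 0")
  case False
  define b where "b = \<kappa> powr (1 / (p - 1))"
  have b: "b > 0" using \<kappa> by (simp add: b_def)
  have "b powr (p - 2) * b = b powr (p - 1)" using powr_mult_base[of b "p - 2"] b by (simp add: mult.commute)
  also have "\<dots> = \<kappa>" using p \<kappa> by (simp add: b_def powr_powr)
  finally have bk: "b powr (p - 2) * b = \<kappa>" .
  \<comment> \<open>As \<open>p_flux q y\<close> has norm |y|^(q-1), the composed flux carries the
    exponent (q - 1)(p - 2) + (q - 2), which this relation turns into \<alpha>.\<close>
  have "q * (p - 1) = \<alpha> + p" using p by (simp add: q)
  then have "(q - 1) * (p - 2) + (q - 2) = \<alpha>" by (simp add: algebra_simps)
  then have "norm (p_flux q y) powr (p - 2) * norm y powr (q - 2) = norm y powr \<alpha>"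
    by (simp add: norm_p_flux powr_powr powr_add[symmetric])
  then have "p_flux p (p_flux q y) = hom_weight \<alpha> y *\<^sub>R y"
    using False by (simp add: p_flux_def[of p] hom_weight_def) (simp add: p_flux_def)
  moreover have "p_flux p (- b *\<^sub>R p_flux q y) = (- \<kappa>) *\<^sub>R p_flux p (p_flux q y)"
    using b bk by (subst p_flux_scaleR) simp
  ultimately show ?thesis unfolding b_def by simp
qed (simp add: p_flux_def)

text \<open>The right-hand side of the conclusion is the height at the centre of the barrier on a
  ball of radius \<open>r\<close>. Take the root of order \<open>p - 1\<close> of the hypothesis: it
  turns the exponent \<alpha> + p into q.\<close>

lemma barrier_height:
  fixes p q r \<alpha> \<kappa> A :: real
  assumes p: "p > 1" and q: "q = (\<alpha> + p) / (p - 1)" "q > 0" and r: "r > 0" and \<kappa>: "\<kappa> > 0" and A: "A \<ge> 0"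
    and lt: "(q * A) powr (p - 1) < \<kappa> * r powr (\<alpha> + p)"
  shows "A < \<kappa> powr (1 / (p - 1)) / q * r powr q"
proof -
  have "((q * A) powr (p - 1)) powr (1 / (p - 1)) < (\<kappa> * r powr (\<alpha> + p)) powr (1 / (p - 1))"
    using lt p by (simp add: powr_less_mono2)
  moreover have "((q * A) powr (p - 1)) powr (1 / (p - 1)) = q * A"
    using p q(2) A by (simp add: powr_powr)
  moreover have "(\<kappa> * r powr (\<alpha> + p)) powr (1 / (p - 1)) = \<kappa> powr (1 / (p - 1)) * r powr q"
    by (simp add: powr_powr powr_mult q(1))
  ultimately have "q * A < \<kappa> powr (1 / (p - 1)) * r powr q" by simp
  then show ?thesis using q(2) by (simp add: field_simps)
qed

text \<open>The common core of both parts. Hypothesis \<open>lam\<close> says that the barrier with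
  source \<open>lam * m * |x - c|^\<alpha>\<close> on the full ball is higher than
  \<open>Fnorm\<close> at its centre, whereas F(u) never exceeds that norm.\<close>

lemma no_supersol_on_large_ball:
  fixes u :: "real^'n::finite \<Rightarrow> real"
  assumes p: "p > 1" and C: "condC a f" and fin: "Fnorm p a f \<noteq> \<infinity>"
    and u: "pos_C1_weak_supersol p a f \<Omega> \<rho> lam u"
    and sub: "ball c R \<subseteq> \<Omega>" and R: "R > 0" and m: "m > 0" and \<alpha>: "\<alpha> \<ge> 0"
    and \<rho>: "\<And>x. x \<in> ball c R \<Longrightarrow> m * hom_weight \<alpha> (x - c) \<le> \<rho> x"
    and lam: "((\<alpha> + p) / (p - 1) * enn2real (Fnorm p a f)) powr (p - 1) * (\<alpha> + real CARD('n))
       < lam * m * R powr (\<alpha> + p)"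
  shows False
proof -
  define N where "N = real CARD('n)"
  define Fn where "Fn = enn2real (Fnorm p a f)"
  define q where "q = (\<alpha> + p) / (p - 1)"
  have N: "N > 0" by (simp add: N_def)
  have Fn: "Fn \<ge> 0" by (simp add: Fn_def)
  have q: "q > 1" using p \<alpha> by (simp add: q_def field_simps)
  \<comment> \<open>Positivity of \<open>lam\<close> is not assumed; it follows because
    \<open>lam\<close> satisfies a strict inequality with nonnegative left side.\<close>
  have "0 \<le> (q * Fn) powr (p - 1) * (\<alpha> + N)" using N \<alpha> by simp
  with lam have "0 < lam * m * R powr (\<alpha> + p)" unfolding q_def Fn_def N_def by linarith
  then have lam0: "lam > 0" using m R by (simp add: zero_less_mult_iff)
  \<comment> \<open>By continuity at t = 1 the strict inequality survives shrinking both
    \<open>lam\<close> and \<open>R\<close> by a factor t < 1. The smaller radius gives compact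
    support in the ball, the smaller parameter gives the strictness that closes the integral
    estimate.\<close>
  obtain t where t: "0 < t" "t < 1" and tT: "(q * Fn) powr (p - 1) * (\<alpha> + N) < t * lam * m * (t * R) powr (\<alpha> + p)"
  proof -
    have "((\<lambda>t. t * lam * m * (t * R) powr (\<alpha> + p)) \<longlongrightarrow> 1 * lam * m * (1 * R) powr (\<alpha> + p)) (at_left 1)"
      using R by (intro tendsto_intros) auto
    moreover have "(q * Fn) powr (p - 1) * (\<alpha> + N) < 1 * lam * m * (1 * R) powr (\<alpha> + p)"
      using lam by (simp add: q_def Fn_def N_def)
    ultimately have "\<forall>\<^sub>F t in at_left 1. (q * Fn) powr (p - 1) * (\<alpha> + N) < t * lam * m * (t * R) powr (\<alpha> + p)"
      by (rule order_tendstoD(1))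
    moreover have "\<forall>\<^sub>F t::real in at_left 1. t \<in> {0<..<1}" by (rule eventually_at_leftI[of 0]) auto
    ultimately have "\<forall>\<^sub>F t in at_left 1. (q * Fn) powr (p - 1) * (\<alpha> + N) < t * lam * m * (t * R) powr (\<alpha> + p) \<and> t \<in> {0<..<1}"
      by (rule eventually_conj)
    from eventually_happens[OF this] that show thesis by auto
  qed
  \<comment> \<open>The divisor \<open>N + \<alpha>\<close> is the factor from the divergence
    identity, so the field \<kappa> |y|^\<alpha> y has divergence t lam m |y|^\<alpha>.\<close>
  define r \<kappa> b where "r = t * R" and "\<kappa> = t * lam * m / (N + \<alpha>)" and "b = \<kappa> powr (1 / (p - 1))"
  have r: "0 < r" "r < R" using t R by (auto simp: r_def)
  have \<kappa>: "\<kappa> > 0" using t lam0 m N \<alpha> by (simp add: \<kappa>_def)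
  have "(q * Fn) powr (p - 1) < \<kappa> * r powr (\<alpha> + p)"
    using tT N \<alpha> by (simp add: \<kappa>_def r_def field_simps)
  then have height: "Fn < b / q * r powr q"
    unfolding b_def using p q r \<kappa> Fn by (intro barrier_height) (auto simp: q_def)

  \<comment> \<open>The radial barrier\<close>
  define w where "w x = b / q * (r powr q - norm (x - c) powr q)" for x
  define gw where "gw x = - b *\<^sub>R p_flux q (x - c)" for x
  have w_der: "(w has_derivative (\<lambda>h. gw x \<bullet> h)) (at x)" for x
  proof -
    have "((\<lambda>x. x - c) has_derivative (\<lambda>h. h)) (at x)" by (auto intro!: derivative_eq_intros)
    from has_derivative_compose[OF this norm_powr_has_derivative[OF q]]
    have "((\<lambda>x. norm (x - c) powr q) has_derivative (\<lambda>h. q * (p_flux q (x - c) \<bullet> h))) (at x)" .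
    from has_derivative_mult_right[OF has_derivative_diff[OF has_derivative_const this], of "b / q" "r powr q"]
    show ?thesis unfolding w_def[abs_def] gw_def using q by simp
  qed
  have gw_c: "continuous_on S gw" for S unfolding gw_def[abs_def]
    by (intro continuous_intros continuous_on_compose2[OF continuous_on_p_flux[OF q]]) auto
  have w_flux: "p_flux p (gw x) = - (\<kappa> * hom_weight \<alpha> (x - c)) *\<^sub>R (x - c)" for x
    unfolding gw_def b_def by (rule p_flux_barrier_gradient[OF p \<alpha> \<kappa>]) (simp add: q_def)

  \<comment> \<open>The nonlinearity and the primitive of its negative power\<close>
  define D where "D = {s. 0 < s \<and> ereal s < a}"
  define g where "g s = f s powr (-1 / (p - 1))" for s
  have D: "open D" unfolding D_def by (rule condC_open)
  obtain f' where f'c: "continuous_on {s. 0 \<le> s \<and> ereal s < a} f'"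
    and f': "\<And>s. 0 \<le> s \<Longrightarrow> ereal s < a \<Longrightarrow> (f has_real_derivative f' s) (at s within {s. 0 \<le> s \<and> ereal s < a})"
    and mono: "mono_on {s. 0 \<le> s \<and> ereal s < a} f" and fpos: "\<And>s. s \<in> D \<Longrightarrow> f s > 0"
    using C unfolding condC_def D_def by auto
  have Dsub: "D \<subseteq> {s. 0 \<le> s \<and> ereal s < a}" by (auto simp: D_def)
  have f'D: "continuous_on D f'" using f'c Dsub by (rule continuous_on_subset)
  have f_der: "(f has_real_derivative f' s) (at s)" if s: "s \<in> D" for s
  proof -
    have "(f has_real_derivative f' s) (at s within D)"
      by (rule DERIV_subset[OF f' Dsub]) (use s in \<open>auto simp: D_def\<close>)
    then show ?thesis using at_within_open[OF s D] by simp
  qed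
  have f'_nonneg: "f' s \<ge> 0" if s: "s \<in> D" for s
    using mono_on_imp_deriv_nonneg[OF mono_on_subset[OF mono Dsub] f_der[OF s]] s D
    by (simp add: interior_open)
  have fc: "continuous_on D f"
    using f_der DERIV_isCont by (blast intro: continuous_at_imp_continuous_on)
  have gc: "continuous_on D g" unfolding g_def[abs_def] using fpos
    by (intro continuous_intros fc) (auto simp: less_imp_neq[symmetric])
  \<comment> \<open>Since g^(p-1) = 1 / f, the flux of grad F(u) = g(u) grad u is the flux of grad u
    divided by f(u).\<close>
  have g_pow: "g s > 0" "g s powr (p - 2) * g s = 1 / f s" if s: "s \<in> D" for s
  proof -
    show "g s > 0" using fpos[OF s] by (simp add: g_def)
    then have "g s powr (p - 2) * g s = g s powr (p - 1)"
      using powr_mult_base[of "g s" "p - 2"] by (simp add: mult.commute)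
    also have "\<dots> = f s powr (-1)" using p by (simp add: g_def powr_powr)
    finally show "g s powr (p - 2) * g s = 1 / f s" using fpos[OF s] by (simp add: powr_minus_divide)
  qed
  obtain F where F_der: "\<And>s. s \<in> D \<Longrightarrow> (F has_real_derivative g s) (at s)"
    and F0: "\<And>s. s \<in> D \<Longrightarrow> 0 \<le> F s" and Fle: "\<And>s. s \<in> D \<Longrightarrow> F s \<le> Fn"
    using Fnorm_primitive_exists[OF p C fin] unfolding D_def g_def Fn_def by blast

  \<comment> \<open>The supersolution on the ball and its transform\<close>
  define B where "B = ball c R"
  obtain gu where "continuous_on \<Omega> gu" and gu: "\<And>x. x \<in> \<Omega> \<Longrightarrow> (u has_derivative (\<lambda>h. gu x \<bullet> h)) (at x)"
    using u unfolding pos_C1_weak_supersol_def C1_on_def by blast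
  then have gu_c: "continuous_on B gu" using sub continuous_on_subset B_def by blast
  have u_der: "(u has_derivative (\<lambda>h. gu x \<bullet> h)) (at x)" if "x \<in> B" for x
    using that gu sub by (auto simp: B_def)
  have uD: "u x \<in> D" if "x \<in> B" for x
    using that u sub unfolding pos_C1_weak_supersol_def D_def B_def by auto
  have u_c: "continuous_on B u"
    using u_der has_derivative_continuous by (blast intro: continuous_at_imp_continuous_on)
  have grad_u: "grad u x = gu x" if "x \<in> B" for x by (rule grad_eqI[OF u_der[OF that]])
  have uDB: "u ` B \<subseteq> D" using uD by auto
  note comp_u = continuous_on_compose2[OF _ u_c uDB]

  define v gv where "v x = F (u x)" and "gv x = g (u x) *\<^sub>R gu x" for x
  have v_der: "(v has_derivative (\<lambda>h. gv x \<bullet> h)) (at x)" if "x \<in> B" for x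
    unfolding v_def[abs_def] gv_def
    using has_derivative_compose[OF u_der[OF that] F_der[OF uD[OF that], unfolded has_field_derivative_def]]
    by simp
  have gv_c: "continuous_on B gv" unfolding gv_def[abs_def]
    by (intro continuous_intros gu_c comp_u gc)
  have v_c: "continuous_on B v"
    using v_der has_derivative_continuous by (blast intro: continuous_at_imp_continuous_on)
  have w_c: "continuous_on B w" using w_der by (rule has_derivative_at_imp_continuous_on)

  \<comment> \<open>The test function and its gradient\<close>
  define \<psi> G\<psi> where "\<psi> x = (max 0 (w x - v x))\<^sup>2"
    and "G\<psi> x = (2 * max 0 (w x - v x)) *\<^sub>R (gw x - gv x)" for x
  have \<psi>_der: "(\<psi> has_derivative (\<lambda>h. G\<psi> x \<bullet> h)) (at x)" if x: "x \<in> B" for x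
  proof -
    have "((\<lambda>x. w x - v x) has_derivative (\<lambda>h. gw x \<bullet> h - gv x \<bullet> h)) (at x)"
      by (intro has_derivative_diff w_der v_der x)
    from has_derivative_compose[OF this max_0_square_has_real_derivative[unfolded has_field_derivative_def]]
    show ?thesis unfolding \<psi>_def[abs_def] G\<psi>_def by (simp add: inner_diff_left)
  qed
  have G\<psi>_c: "continuous_on B G\<psi>" unfolding G\<psi>_def[abs_def]
    by (intro continuous_intros w_c v_c gw_c gv_c)
  have \<psi>_c: "continuous_on B \<psi>" unfolding \<psi>_def[abs_def]
    by (intro continuous_intros w_c v_c)
  \<comment> \<open>Outside the smaller ball \<open>w \<le> 0 \<le> v\<close>, so the positive part
    vanishes there.\<close>
  have \<psi>_z: "\<psi> x = 0" if x: "x \<in> B - cball c r" for x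
  proof -
    have "r < norm (x - c)" using x by (simp add: dist_norm norm_minus_commute)
    then have "r powr q \<le> norm (x - c) powr q" using r q by (intro powr_mono2) auto
    moreover have "0 \<le> b / q" using q by (simp add: b_def)
    ultimately have "w x \<le> 0" unfolding w_def by (intro mult_nonneg_nonpos) auto
    moreover have "0 \<le> v x" unfolding v_def using x uD F0 by simp
    ultimately show ?thesis by (simp add: \<psi>_def)
  qed
  \<comment> \<open>Division by f(u) cancels the factor f(u) in the source term and turns the flux
    of \<open>u\<close> into the flux of \<open>v\<close>: the inequality for \<open>u\<close>
    tested with \<open>\<phi>\<close> acts as one for \<open>v\<close> tested with
    \<open>\<psi>\<close>.\<close>
  define \<phi> G\<phi> where "\<phi> x = \<psi> x / f (u x)"
    and "G\<phi> x = (1 / f (u x)) *\<^sub>R G\<psi> x - (\<psi> x * f' (u x) / (f (u x))\<^sup>2) *\<^sub>R gu x" for x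
  have \<phi>_der: "(\<phi> has_derivative (\<lambda>h. G\<phi> x \<bullet> h)) (at x)" if x: "x \<in> B" for x
  proof -
    have fx: "f (u x) > 0" using fpos uD x by auto
    have fu: "((\<lambda>x. f (u x)) has_derivative (\<lambda>h. f' (u x) * (gu x \<bullet> h))) (at x)"
      using has_derivative_compose[OF u_der[OF x] f_der[OF uD[OF x], unfolded has_field_derivative_def]] .
    show ?thesis unfolding \<phi>_def[abs_def] G\<phi>_def
      by (rule has_derivative_eq_rhs[OF has_derivative_divide'[OF \<psi>_der[OF x] fu]])
         (use fx in \<open>auto simp: inner_diff_left field_simps power2_eq_square\<close>)
  qed
  have fu0: "f (u x) \<noteq> 0" if "x \<in> B" for x using fpos[OF uD[OF that]] by simp
  have G\<phi>_c: "continuous_on B G\<phi>" unfolding G\<phi>_def[abs_def]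
    by (intro continuous_intros G\<psi>_c \<psi>_c gu_c comp_u fc f'D) (use fu0 in auto)
  have \<phi>_z: "\<phi> x = 0" if "x \<in> B - cball c r" for x using \<psi>_z[OF that] by (simp add: \<phi>_def)

  have pointwise: "p_flux p (gu x) \<bullet> G\<phi> x \<le> - \<kappa> * (hom_weight \<alpha> (x - c) * ((x - c) \<bullet> G\<psi> x))"
    if x: "x \<in> B" for x
  proof -
    define P where "P = max 0 (w x - v x)"
    have fx: "f (u x) > 0" and gx: "g (u x) > 0" using fpos g_pow(1) uD x by auto
    have "p_flux p (gv x) = (1 / f (u x)) *\<^sub>R p_flux p (gu x)"
      unfolding gv_def p_flux_scaleR using g_pow[OF uD[OF x]] by simp
    then have gvf: "p_flux p (gv x) \<bullet> z = (1 / f (u x)) * (p_flux p (gu x) \<bullet> z)" for z by simp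
    have "0 \<le> (\<psi> x * f' (u x) / (f (u x))\<^sup>2) * (p_flux p (gu x) \<bullet> gu x)"
      using f'_nonneg[OF uD[OF x]] by (intro mult_nonneg_nonneg divide_nonneg_nonneg) (auto simp: \<psi>_def p_flux_def)
    then have "p_flux p (gu x) \<bullet> G\<phi> x \<le> (1 / f (u x)) * (p_flux p (gu x) \<bullet> G\<psi> x)"
      by (simp add: G\<phi>_def inner_diff_right)
    also have "\<dots> = p_flux p (gv x) \<bullet> G\<psi> x" by (simp add: gvf)
    also have "\<dots> = 2 * P * (p_flux p (gv x) \<bullet> (gw x - gv x))" by (simp add: G\<psi>_def P_def)
    also have "\<dots> \<le> 2 * P * (p_flux p (gw x) \<bullet> (gw x - gv x))"
      by (intro mult_left_mono p_flux_monotone p) (simp add: P_def)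
    also have "\<dots> = p_flux p (gw x) \<bullet> G\<psi> x" by (simp add: G\<psi>_def P_def)
    also have "\<dots> = - \<kappa> * (hom_weight \<alpha> (x - c) * ((x - c) \<bullet> G\<psi> x))" by (simp add: w_flux)
    finally show ?thesis .
  qed

  \<comment> \<open>Extension by zero to the whole space\<close>
  have oB: "open B" and cK: "closed (cball c r)" and KB: "cball c r \<subseteq> B" and B\<Omega>: "B \<subseteq> \<Omega>"
    using r sub by (auto simp: B_def)
  define \<psi>E G\<psi>E \<phi>E G\<phi>E where "\<psi>E x = (if x \<in> B then \<psi> x else 0)" and "G\<psi>E x = (if x \<in> B then G\<psi> x else 0)"
    and "\<phi>E x = (if x \<in> B then \<phi> x else 0)" and "G\<phi>E x = (if x \<in> B then G\<phi> x else 0)" for x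
  note \<psi>E = C1_zero_extension[OF oB cK KB \<psi>_der G\<psi>_c \<psi>_z, folded \<psi>E_def G\<psi>E_def]
  note \<phi>E = C1_zero_extension[OF oB cK KB \<phi>_der G\<phi>_c \<phi>_z, folded \<phi>E_def G\<phi>E_def]
  have \<psi>E_z: "\<psi>E x = 0" if "x \<notin> cball c r" for x using that \<psi>_z by (auto simp: \<psi>E_def)
  have \<phi>E_z: "\<phi>E x = 0" if "x \<notin> cball c r" for x using that \<phi>_z by (auto simp: \<phi>E_def)
  have \<phi>E_n: "0 \<le> \<phi>E x" for x
    using fpos[OF uD] by (auto simp: \<phi>E_def \<phi>_def \<psi>_def intro!: divide_nonneg_pos)
  have \<psi>E_n: "0 \<le> \<psi>E x" for x by (simp add: \<psi>E_def \<psi>_def)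
  have G\<phi>E_z: "G\<phi>E x = 0" if "x \<notin> cball c r" for x
    by (rule has_derivative_vanishes_off_closed[OF \<phi>E(1) cK \<phi>E_z that])
  have G\<psi>E_z: "G\<psi>E x = 0" if "x \<notin> cball c r" for x
    by (rule has_derivative_vanishes_off_closed[OF \<psi>E(1) cK \<psi>E_z that])
  have \<psi>E_c: "continuous_on S \<psi>E" for S using \<psi>E(1) by (rule has_derivative_at_imp_continuous_on)
  have k_c: "continuous_on S (\<lambda>x. hom_weight \<alpha> (x - c))" for S
    by (intro continuous_on_compose2[OF continuous_on_hom_weight[OF \<alpha>]] continuous_intros) auto
  obtain e where e: "cball c R \<subseteq> box (-e) e" using bounded_subset_box_symmetric[OF bounded_cball] by blast
  have e': "x \<notin> cball c r" if "x \<notin> cbox (-e) e" for x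
    using that e box_subset_cbox[of "-e" e] subset_cball[OF less_imp_le[OF r(2)], of c] by blast

  \<comment> \<open>The weighted mass of the squared positive part of \<open>w - v\<close>; the aim
    is to show that it is 0.\<close>
  define I where "I = integral\<^sup>L lborel (\<lambda>x. hom_weight \<alpha> (x - c) * \<psi>E x)"
  have kp_c: "continuous_on S (\<lambda>x. hom_weight \<alpha> (x - c) * \<psi>E x)" for S
    by (intro continuous_intros k_c \<psi>E_c)
  have kp_i: "integrable lborel (\<lambda>x. hom_weight \<alpha> (x - c) * \<psi>E x)"
    and kp_I: "I = integral (cbox (-e) e) (\<lambda>x. hom_weight \<alpha> (x - c) * \<psi>E x)"
    unfolding I_def using compact_support_lborel[OF kp_c, of "-e" e] \<psi>E_z e' by simp_all
  have kg_c: "continuous_on UNIV (\<lambda>x. - \<kappa> * (hom_weight \<alpha> (x - c) * ((x - c) \<bullet> G\<psi>E x)))"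
    by (intro continuous_intros k_c \<psi>E(2))
  have kg_i: "integrable lborel (\<lambda>x. - \<kappa> * (hom_weight \<alpha> (x - c) * ((x - c) \<bullet> G\<psi>E x)))"
    by (rule compact_support_lborel(1)[OF kg_c, of "-e" e]) (use G\<psi>E_z e' in simp)
  have kp_m: "(\<lambda>x. hom_weight \<alpha> (x - c) * \<psi>E x) \<in> borel_measurable lborel"
    and kg_m: "(\<lambda>x. - \<kappa> * (hom_weight \<alpha> (x - c) * ((x - c) \<bullet> G\<psi>E x))) \<in> borel_measurable lborel"
    using borel_measurable_integrable[OF kp_i] borel_measurable_integrable[OF kg_i] .
  have si: "set_integrable lebesgue \<Omega> (\<lambda>x. \<rho> x * f (u x))"
    using u unfolding pos_C1_weak_supersol_def by blast
  have \<phi>E_c: "continuous_on UNIV \<phi>E" using \<phi>E(1) by (rule has_derivative_at_imp_continuous_on)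

  \<comment> \<open>The chain starting here bounds \<open>lam * m * I\<close> by the source term, by
    the flux term of \<open>u\<close>, by the flux term of \<open>w\<close>, and, through the
    divergence identity, by \<open>t * lam * m * I\<close>. As t < 1, this forces
    \<open>I \<le> 0\<close>.\<close>
  have "lam * (m * I) \<le> lam * set_lebesgue_integral lebesgue \<Omega> (\<lambda>x. \<rho> x * f (u x) * \<phi>E x)"
  proof (rule mult_left_mono)
    have "m * I = integral\<^sup>L lebesgue (\<lambda>x. m * (hom_weight \<alpha> (x - c) * \<psi>E x))"
      unfolding I_def using integral_completion[OF kp_m] by simp
    also have "\<dots> \<le> integral\<^sup>L lebesgue (\<lambda>x. indicator \<Omega> x *\<^sub>R (\<rho> x * f (u x) * \<phi>E x))"
    proof (rule integral_mono)
      show "integrable lebesgue (\<lambda>x. m * (hom_weight \<alpha> (x - c) * \<psi>E x))"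
        using kp_i integrable_completion[OF kp_m] by simp
      show "integrable lebesgue (\<lambda>x. indicator \<Omega> x *\<^sub>R (\<rho> x * f (u x) * \<phi>E x))"
        using integrable_mult_bounded_continuous[OF si \<phi>E_c \<phi>E_z] by (simp add: set_integrable_def)
      fix x
      show "m * (hom_weight \<alpha> (x - c) * \<psi>E x) \<le> indicator \<Omega> x *\<^sub>R (\<rho> x * f (u x) * \<phi>E x)"
      proof (cases "x \<in> B")
        case True
        have "m * hom_weight \<alpha> (x - c) * \<psi>E x \<le> \<rho> x * \<psi>E x"
          using \<rho>[of x] True by (intro mult_right_mono \<psi>E_n) (auto simp: B_def)
        moreover have "f (u x) * \<phi>E x = \<psi>E x" using True fu0 by (simp add: \<phi>E_def \<psi>E_def \<phi>_def)
        ultimately show ?thesis using True B\<Omega> by (auto simp: mult.assoc)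
      qed (simp add: \<psi>E_def \<phi>E_def)
    qed
    finally show "m * I \<le> set_lebesgue_integral lebesgue \<Omega> (\<lambda>x. \<rho> x * f (u x) * \<phi>E x)"
      by (simp add: set_lebesgue_integral_def)
  qed (use lam0 in simp)
  also have "\<dots> \<le> set_lebesgue_integral lebesgue \<Omega> (\<lambda>x. p_flux p (grad u x) \<bullet> G\<phi>E x)"
  proof (rule supersol_C1_test[OF p u _ _ \<phi>E \<phi>E_z \<phi>E_n])
    \<comment> \<open>Only the open ball of radius \<open>R\<close> is known to lie in
      \<open>\<Omega>\<close>, so the closed ball that gives room for mollification gets a radius
      strictly between \<open>r\<close> and \<open>R\<close>.\<close>
    show "cball c ((r + R) / 2) \<subseteq> \<Omega>" using r sub by (auto simp: subset_iff)
    show "r < (r + R) / 2" using r by simp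
  qed
  also have "\<dots> \<le> integral\<^sup>L lebesgue (\<lambda>x. - \<kappa> * (hom_weight \<alpha> (x - c) * ((x - c) \<bullet> G\<psi>E x)))"
    unfolding set_lebesgue_integral_def
  proof (rule integral_mono)
    have "continuous_on B (\<lambda>x. p_flux p (gu x))"
      by (rule continuous_on_compose2[OF continuous_on_p_flux[OF p] gu_c subset_UNIV])
    then have "continuous_on B (\<lambda>x. p_flux p (grad u x))" by (rule continuous_on_eq) (simp add: grad_u)
    then have "set_integrable lebesgue \<Omega> (\<lambda>x. p_flux p (grad u x) \<bullet> G\<phi>E x)"
      using KB B\<Omega> continuous_on_subset[OF \<phi>E(2)] G\<phi>E_z
      by (intro set_integrable_inner_compact_support[where K="cball c r"]) (auto intro: continuous_on_subset)
    then show "integrable lebesgue (\<lambda>x. indicator \<Omega> x *\<^sub>R (p_flux p (grad u x) \<bullet> G\<phi>E x))"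
      by (simp add: set_integrable_def)
    show "integrable lebesgue (\<lambda>x. - \<kappa> * (hom_weight \<alpha> (x - c) * ((x - c) \<bullet> G\<psi>E x)))"
      using kg_i integrable_completion[OF kg_m] by simp
    fix x
    show "indicator \<Omega> x *\<^sub>R (p_flux p (grad u x) \<bullet> G\<phi>E x) \<le> - \<kappa> * (hom_weight \<alpha> (x - c) * ((x - c) \<bullet> G\<psi>E x))"
      using pointwise[of x] B\<Omega> by (cases "x \<in> B") (auto simp: G\<phi>E_def G\<psi>E_def grad_u)
  qed
  also have "\<dots> = - \<kappa> * integral\<^sup>L lborel (\<lambda>x. hom_weight \<alpha> (x - c) * ((x - c) \<bullet> G\<psi>E x))"
    using integral_completion[OF kg_m] by simp
  also have "\<dots> = - \<kappa> * (- (N + \<alpha>) * I)"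
    unfolding I_def N_def
    using homogeneous_weight_scaling_identity_centered[OF continuous_on_hom_weight[OF \<alpha>] hom_weight_scaleR \<psi>E \<psi>E_z]
    by simp
  also have "\<dots> = t * (lam * (m * I))" using N \<alpha> by (simp add: \<kappa>_def field_simps)
  finally have "(1 - t) * (lam * (m * I)) \<le> 0" by (simp add: algebra_simps)
  then have "I \<le> 0" using t lam0 m by (simp add: mult_le_0_iff)
  moreover have "0 \<le> I" unfolding I_def using \<psi>E_n by (intro Bochner_Integration.integral_nonneg) (simp add: hom_weight_def)
  ultimately have "((\<lambda>x. hom_weight \<alpha> (x - c) * \<psi>E x) has_integral 0) (cbox (-e) e)"
    using kp_I integrable_integral[OF integrable_continuous[OF kp_c], of "-e" e] by simp
  then have kp0: "hom_weight \<alpha> (x - c) * \<psi>E x = 0" if "x \<in> cbox (-e) e" for x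
    using that e R by (intro has_integral_0_cbox_imp_0[OF kp_c]) (auto simp: hom_weight_def \<psi>E_n)
  \<comment> \<open>For \<alpha> > 0 the weight vanishes at \<open>c\<close>, so the vanishing
    integrand says nothing there; the value at the centre is recovered by continuity.\<close>
  have "\<psi>E x = 0" if "x \<noteq> c" for x
  proof (cases "x \<in> cbox (-e) e")
    case True
    have "hom_weight \<alpha> (x - c) \<noteq> 0" using that by (simp add: hom_weight_def)
    then show ?thesis using kp0[OF True] by simp
  qed (rule \<psi>E_z[OF e'])
  then have "\<forall>\<^sub>F x in at c. \<psi>E x = 0" by (auto simp: eventually_at_filter)
  then have "(\<psi>E \<longlongrightarrow> 0) (at c)" by (simp add: tendsto_eventually)
  moreover have "(\<psi>E \<longlongrightarrow> \<psi>E c) (at c)" using \<psi>E_c[of UNIV] unfolding continuous_on_def by auto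
  ultimately have "\<psi>E c = 0" using tendsto_unique[OF at_neq_bot] by blast
  moreover have "c \<in> B" using R by (simp add: B_def)
  then have "v c \<le> Fn" "c \<in> B" unfolding v_def using Fle uD by auto
  \<comment> \<open>At the centre the barrier attains the height \<open>b / q * r powr q\<close>, so
    \<open>w c > v c\<close> and \<open>\<psi>E c\<close> would be positive.\<close>
  moreover have "w c > Fn" using height q by (simp add: w_def)
  ultimately show False by (simp add: \<psi>E_def \<psi>_def)
qed

section \<open>The ball criterion applied to general domains and to power weights\<close>

theorem theorem4p1:
  fixes p :: real and a :: ereal and f :: "real \<Rightarrow> real"
  assumes "p > 1"
    and "condC a f"
    and "Fnorm p a f \<noteq> \<infinity>"
  shows
  "(\<forall>(\<Omega> :: (real^'n::finite) set) \<rho> lam.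
      smooth_bounded_domain \<Omega> \<and> bounded (\<rho> ` \<Omega>) \<and> (\<forall>x\<in>\<Omega>. 0 \<le> \<rho> x) \<and>
      (\<exists>x\<in>\<Omega>. \<rho> x \<noteq> 0) \<and>
      (let d = (\<lambda>x. infdist x (frontier \<Omega>));
           S = Sup ((\<lambda>x. Inf (\<rho> ` ball x (d x)) * d x powr p) ` \<Omega>)
       in S > 0 \<and>
          lam > (p / (p - 1)) powr (p - 1) * real CARD('n)
                  * enn2real (Fnorm p a f) powr (p - 1) / S)
      \<longrightarrow> \<not> (\<exists>u. pos_C1_weak_supersol p a f \<Omega> \<rho> lam u))
   \<and>
   (\<forall>(R :: real) (\<alpha> :: real) lam.
      R > 0 \<and> \<alpha> > 0 \<and>
      lam > ((\<alpha> + p) / (p - 1) * enn2real (Fnorm p a f)) powr (p - 1)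
              * (\<alpha> + real CARD('n)) * R powr (-(\<alpha> + p))
      \<longrightarrow> \<not> (\<exists>u. pos_C1_weak_supersol p a f (ball (0 :: real^'n) R) (\<lambda>x. norm x powr \<alpha>) lam u))"
proof (intro conjI allI impI notI)
  fix \<Omega> :: "(real^'n) set" and \<rho> lam
  assume H: "smooth_bounded_domain \<Omega> \<and> bounded (\<rho> ` \<Omega>) \<and> (\<forall>x\<in>\<Omega>. 0 \<le> \<rho> x) \<and>
      (\<exists>x\<in>\<Omega>. \<rho> x \<noteq> 0) \<and>
      (let d = (\<lambda>x. infdist x (frontier \<Omega>));
           S = Sup ((\<lambda>x. Inf (\<rho> ` ball x (d x)) * d x powr p) ` \<Omega>)
       in S > 0 \<and>
          lam > (p / (p - 1)) powr (p - 1) * real CARD('n)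
                  * enn2real (Fnorm p a f) powr (p - 1) / S)"
    and "\<exists>u. pos_C1_weak_supersol p a f \<Omega> \<rho> lam u"
  then obtain u where u: "pos_C1_weak_supersol p a f \<Omega> \<rho> lam u" by blast
  define d where "d x = infdist x (frontier \<Omega>)" for x
  define S where "S = Sup ((\<lambda>x. Inf (\<rho> ` ball x (d x)) * d x powr p) ` \<Omega>)"
  define T where "T = (p / (p - 1)) powr (p - 1) * real CARD('n) * enn2real (Fnorm p a f) powr (p - 1)"
  have S: "S > 0" "lam > T / S" and \<rho>0: "\<And>x. x \<in> \<Omega> \<Longrightarrow> 0 \<le> \<rho> x" and "\<Omega> \<noteq> {}"
    using H unfolding S_def T_def d_def Let_def smooth_bounded_domain_def by auto
  have T: "T \<ge> 0" unfolding T_def by simp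
  then have "0 \<le> T / S" using S(1) by simp
  with S(2) have lam0: "lam > 0" by linarith
  \<comment> \<open>The supremum need not be attained, but T / lam < S, so some point already gives
    a value above T / lam. Its inscribed ball, with \<open>m\<close> the infimum of
    \<open>\<rho>\<close> there, is used with \<alpha> = 0.\<close>
  have "\<exists>x\<in>\<Omega>. T / lam < Inf (\<rho> ` ball x (d x)) * d x powr p"
  proof (rule ccontr)
    assume "\<not> ?thesis"
    then have "S \<le> T / lam" unfolding S_def using \<open>\<Omega> \<noteq> {}\<close> by (intro cSup_least) (auto simp: not_less)
    then show False using S lam0 by (simp add: field_simps)
  qed
  then obtain x where x: "x \<in> \<Omega>" and big: "T / lam < Inf (\<rho> ` ball x (d x)) * d x powr p" by blast
  define m where "m = Inf (\<rho> ` ball x (d x))"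
  have "0 \<le> T / lam" using T lam0 by simp
  with big have md: "0 < m * d x powr p" unfolding m_def by linarith
  have "d x \<ge> 0" by (simp add: d_def infdist_nonneg)
  \<comment> \<open>If the distance were 0, the positive product would vanish, as
    \<open>0 powr p = 0\<close>.\<close>
  moreover have "d x \<noteq> 0" using md by auto
  ultimately have dx: "d x > 0" by simp
  with md have m: "m > 0" by (simp add: zero_less_mult_iff)
  \<comment> \<open>A ball is connected, so one that meets both \<open>\<Omega>\<close> and its
    complement contains a frontier point, closer to \<open>x\<close> than the distance
    \<open>d x\<close>.\<close>
  have sub: "ball x (d x) \<subseteq> \<Omega>"
  proof (rule ccontr)
    assume "\<not> ball x (d x) \<subseteq> \<Omega>"
    moreover have "x \<in> ball x (d x) \<inter> \<Omega>" using x dx by simp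
    ultimately have "ball x (d x) \<inter> frontier \<Omega> \<noteq> {}"
      by (intro connected_Int_frontier connected_ball) blast+
    then obtain y where "y \<in> ball x (d x) \<inter> frontier \<Omega>" by blast
    then show False using infdist_le[of y "frontier \<Omega>" x] by (simp add: d_def)
  qed
  have "bdd_below (\<rho> ` ball x (d x))" using \<rho>0 sub by (intro bdd_belowI[of _ 0]) auto
  then have "m * hom_weight 0 (y - x) \<le> \<rho> y" if "y \<in> ball x (d x)" for y
    unfolding hom_weight_def m_def using that by (simp add: cInf_lower)
  moreover have "((0 + p) / (p - 1) * enn2real (Fnorm p a f)) powr (p - 1) * (0 + real CARD('n))
       < lam * m * d x powr (0 + p)"
  proof -
    have "T < lam * (m * d x powr p)" using big lam0 by (simp add: m_def field_simps)
    moreover have "((0 + p) / (p - 1) * enn2real (Fnorm p a f)) powr (p - 1) * (0 + real CARD('n)) = T"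
      using powr_mult[of "p / (p - 1)" "enn2real (Fnorm p a f)" "p - 1"] by (simp add: T_def)
    ultimately show ?thesis by (simp add: mult.assoc)
  qed
  ultimately show False
    using no_supersol_on_large_ball[OF assms u sub dx m order_refl] by blast
next
  fix R \<alpha> lam :: real
  assume H: "R > 0 \<and> \<alpha> > 0 \<and>
      lam > ((\<alpha> + p) / (p - 1) * enn2real (Fnorm p a f)) powr (p - 1)
              * (\<alpha> + real CARD('n)) * R powr (-(\<alpha> + p))"
    and "\<exists>u. pos_C1_weak_supersol p a f (ball (0 :: real^'n) R) (\<lambda>x. norm x powr \<alpha>) lam u"
  then obtain u where u: "pos_C1_weak_supersol p a f (ball (0 :: real^'n) R) (\<lambda>x. norm x powr \<alpha>) lam u" by blast
  have R: "R > 0" and \<alpha>: "\<alpha> > 0" using H by auto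
  have "((\<alpha> + p) / (p - 1) * enn2real (Fnorm p a f)) powr (p - 1) * (\<alpha> + real CARD('n)) * R powr (-(\<alpha> + p))
      * R powr (\<alpha> + p) < lam * R powr (\<alpha> + p)"
    using H R by (intro mult_strict_right_mono) auto
  moreover have "R powr (-(\<alpha> + p)) * R powr (\<alpha> + p) = 1" using R by (simp add: powr_add[symmetric])
  ultimately have "((\<alpha> + p) / (p - 1) * enn2real (Fnorm p a f)) powr (p - 1) * (\<alpha> + real CARD('n))
       < lam * 1 * R powr (\<alpha> + p)"
    by (simp add: mult.assoc)
  \<comment> \<open>Centre 0 and m = 1: the weight is exactly the given density, since \<alpha> >
    0.\<close>
  moreover have "1 * hom_weight \<alpha> (x - 0) \<le> norm x powr \<alpha>" for x :: "real^'n"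
    using \<alpha> by (simp add: hom_weight_def)
  ultimately show False
    using no_supersol_on_large_ball[OF assms u subset_refl R zero_less_one less_imp_le[OF \<alpha>]] by blast
qed

end
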